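(* Let $\delta\ge 3$ and $n\ge \delta^2+\delta+1$ be integers, and let $G$ be a connected graph of order $n$ with minimum degree $\delta(G)\ge\delta$. If $\rho(G)\ge\rho(\mathcal A_{n,\delta})$, then $G$ has an even factor unless $G\cong\mathcal A_{n,\delta}$.
   Context: All graphs are finite, simple and undirected. $\rho(G)$ denotes the spectral radius, i.e. the largest eigenvalue of the adjacency matrix of $G$. An even factor of $G$ is a spanning subgraph $F$ of $G$ in which $d_F(v)$ is a positive even integer for every $v\in V(G)$. For $\delta\ge3$ and $n\ge\delta^2+\delta+1$, the graph $\mathcal A_{n,\delta}$ of order $n$ is constructed as follows: take one vertex $u$, a clique $C_0\cong K_{n-\delta^2}$, and $\delta-1$ further cliques $C_1,\ldots,C_{\delta-1}\cong K_{\delta+1}$ (all pairwise vertex-disjoint and not containing $u$); choose one root vertex $a_i\in V(C_i)$ for each $i=0,1,\ldots,\delta-1$, and add exactly the $\delta$ edges $ua_i$. *)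

theory Defs
  imports "Graph_Theory.Graph_Theory" "Jordan_Normal_Form.Char_Poly"
begin

text \<open>
  A finite simple undirected graph is a \<open>pair_graph\<close>: a finite, loop-free digraph with a symmetric
  arc relation, in which an undirected edge \<open>uv\<close> is the pair of arcs \<open>(u, v)\<close>, \<open>(v, u)\<close>.
  The degree of a vertex is therefore its \<open>out_degree\<close>.
\<close>

definition min_degree :: "'a pair_pre_digraph \<Rightarrow> nat" where
  "min_degree G = Min (out_degree (with_proj G) ` pverts G)"

definition even_factor :: "'a pair_pre_digraph \<Rightarrow> 'a pair_pre_digraph \<Rightarrow> bool" where
  "even_factor F G \<longleftrightarrow> pair_graph F \<and> spanning (with_proj F) (with_proj G) \<and>
     (\<forall>v\<in>pverts G. even (out_degree (with_proj F) v) \<and> out_degree (with_proj F) v > 0)"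

text \<open>
  Matrices are indexed by natural numbers, so the adjacency matrix is taken with respect to an
  enumeration of the vertices. The choice of enumeration does not affect the eigenvalues,
  see \<open>eigenvalue_adjacency_matrix_iff\<close> below.
\<close>

definition vertex_list :: "'a pair_pre_digraph \<Rightarrow> 'a list" where
  "vertex_list G = (SOME vs. distinct vs \<and> set vs = pverts G)"

definition adjacency_matrix_wrt :: "'a list \<Rightarrow> 'a pair_pre_digraph \<Rightarrow> real mat" where
  "adjacency_matrix_wrt vs G = mat (length vs) (length vs)
     (\<lambda>(i, j). if (vs ! i, vs ! j) \<in> parcs G then 1 else 0)"

definition adjacency_matrix :: "'a pair_pre_digraph \<Rightarrow> real mat" where
  "adjacency_matrix G = adjacency_matrix_wrt (vertex_list G) G"

definition graph_spectral_radius :: "'a pair_pre_digraph \<Rightarrow> real" where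
  "graph_spectral_radius G = Max {k. eigenvalue (adjacency_matrix G) k}"

text \<open>\<open>Hub\<close> is the vertex \<open>u\<close>; \<open>Cl i j\<close> is the \<open>j\<close>-th vertex of the clique \<open>C\<^sub>i\<close>, whose root is \<open>Cl i 0\<close>.\<close>

datatype A_vertex = Hub | Cl nat nat

definition clique_size :: "nat \<Rightarrow> nat \<Rightarrow> nat \<Rightarrow> nat" where
  "clique_size n d i = (if i = 0 then n - d\<^sup>2 else d + 1)"

definition A_graph :: "nat \<Rightarrow> nat \<Rightarrow> A_vertex pair_pre_digraph" where
  "A_graph n d = \<lparr>
     pverts = {Hub} \<union> {Cl i j | i j. i < d \<and> j < clique_size n d i},
     parcs = {(Cl i j, Cl i k) | i j k.
                i < d \<and> j < clique_size n d i \<and> k < clique_size n d i \<and> j \<noteq> k}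
           \<union> {(Hub, Cl i 0) | i. i < d} \<union> {(Cl i 0, Hub) | i. i < d} \<rparr>"

lemma eigenvalue_adjacency_matrix_wrt_iff:
  assumes G: "pair_graph G" and vs: "distinct vs" "set vs = pverts G"
  shows "eigenvalue (adjacency_matrix_wrt vs G) k \<longleftrightarrow>
    (\<exists>x. (\<exists>v\<in>pverts G. x v \<noteq> 0) \<and>
         (\<forall>v\<in>pverts G. (\<Sum>w | (v, w) \<in> parcs G. x w) = k * x v))"
proof -
  interpret pair_graph G by (rule G)
  let ?n = "length vs" let ?A = "adjacency_matrix_wrt vs G"
  have bij: "bij_betw (\<lambda>i. vs ! i) {0..<?n} (pverts G)"
    using bij_betw_nth[OF vs(1), of "{0..<?n}" "pverts G"] vs(2)
    by (simp add: lessThan_atLeast0)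
  have fin: "finite (pverts G)" by (rule pair_finite_verts)
  have mult: "(?A *\<^sub>v vec ?n (\<lambda>i. x (vs ! i))) $ i = (\<Sum>w | (vs ! i, w) \<in> parcs G. x w)"
    if i: "i < ?n" for x :: "'a \<Rightarrow> real" and i
  proof -
    have "(?A *\<^sub>v vec ?n (\<lambda>i. x (vs ! i))) $ i
        = (\<Sum>j = 0..<?n. (if (vs ! i, vs ! j) \<in> parcs G then 1 else 0) * x (vs ! j))"
      using i by (simp add: adjacency_matrix_wrt_def scalar_prod_def)
    also have "\<dots> = (\<Sum>w\<in>pverts G. (if (vs ! i, w) \<in> parcs G then 1 else 0) * x w)"
      by (rule sum.reindex_bij_betw[OF bij])
    also have "\<dots> = (\<Sum>w\<in>pverts G. if (vs ! i, w) \<in> parcs G then x w else 0)"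
      by (rule sum.cong) auto
    also have "\<dots> = (\<Sum>w\<in>{w\<in>pverts G. (vs ! i, w) \<in> parcs G}. x w)"
      using fin by (simp add: sum.inter_filter)
    also have "{w\<in>pverts G. (vs ! i, w) \<in> parcs G} = {w. (vs ! i, w) \<in> parcs G}"
      using in_arcsD2 by blast
    finally show ?thesis .
  qed
  show ?thesis
  proof
    assume "eigenvalue ?A k"
    then obtain y where y: "y \<in> carrier_vec ?n" "y \<noteq> 0\<^sub>v ?n" "?A *\<^sub>v y = k \<cdot>\<^sub>v y"
      by (auto simp: eigenvalue_def eigenvector_def adjacency_matrix_wrt_def)
    define x where "x v = y $ (the_inv_into {0..<?n} (\<lambda>i. vs ! i) v)" for v
    have xi: "x (vs ! i) = y $ i" if "i < ?n" for i
      using that the_inv_into_f_f[OF bij_betw_imp_inj_on[OF bij], of i] by (simp add: x_def)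
    have yx: "y = vec ?n (\<lambda>i. x (vs ! i))"
      using y(1) by (intro eq_vecI) (auto simp: xi)
    have "\<not> (\<forall>i<?n. y $ i = 0)"
    proof
      assume "\<forall>i<?n. y $ i = 0"
      hence "y = 0\<^sub>v ?n" using y(1) by (intro eq_vecI) auto
      thus False using y(2) by blast
    qed
    then obtain i where i: "i < ?n" "y $ i \<noteq> 0" by blast
    have "vs ! i \<in> pverts G" using i(1) vs(2) nth_mem[of i vs] by blast
    moreover have "x (vs ! i) \<noteq> 0" using i xi by simp
    ultimately have "\<exists>v\<in>pverts G. x v \<noteq> 0" by blast
    moreover have "(\<Sum>w | (v, w) \<in> parcs G. x w) = k * x v" if "v \<in> pverts G" for v
    proof -
      have "v \<in> set vs" using that vs(2) by simp
      then obtain i where i: "i < ?n" "v = vs ! i" unfolding in_set_conv_nth by blast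
      have "(?A *\<^sub>v y) $ i = (k \<cdot>\<^sub>v y) $ i" using y(3) by simp
      thus ?thesis using mult[OF i(1), of x] i y(1) xi yx[symmetric] by simp
    qed
    ultimately show "\<exists>x. (\<exists>v\<in>pverts G. x v \<noteq> 0) \<and>
        (\<forall>v\<in>pverts G. (\<Sum>w | (v, w) \<in> parcs G. x w) = k * x v)" by blast
  next
    assume "\<exists>x. (\<exists>v\<in>pverts G. x v \<noteq> 0) \<and>
        (\<forall>v\<in>pverts G. (\<Sum>w | (v, w) \<in> parcs G. x w) = k * x v)"
    then obtain x v where x: "v \<in> pverts G" "x v \<noteq> 0"
      "\<And>v. v \<in> pverts G \<Longrightarrow> (\<Sum>w | (v, w) \<in> parcs G. x w) = k * x v" by blast
    let ?y = "vec ?n (\<lambda>i. x (vs ! i))"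
    have "v \<in> set vs" using x(1) vs(2) by simp
    then obtain i where i: "i < ?n" "v = vs ! i" unfolding in_set_conv_nth by blast
    have "?y \<noteq> 0\<^sub>v ?n"
    proof
      assume "?y = 0\<^sub>v ?n"
      hence "?y $ i = 0\<^sub>v ?n $ i" by simp
      thus False using i x(2) by simp
    qed
    moreover have "?A *\<^sub>v ?y = k \<cdot>\<^sub>v ?y"
    proof (rule eq_vecI)
      fix i assume "i < dim_vec (k \<cdot>\<^sub>v ?y)"
      hence i: "i < ?n" by simp
      hence "vs ! i \<in> pverts G" using vs(2) nth_mem by blast
      thus "(?A *\<^sub>v ?y) $ i = (k \<cdot>\<^sub>v ?y) $ i" using mult[OF i, of x] x(3) i by simp
    qed (simp add: adjacency_matrix_wrt_def)
    ultimately show "eigenvalue ?A k"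
      by (auto simp: eigenvalue_def eigenvector_def adjacency_matrix_wrt_def intro!: exI[of _ ?y])
  qed
qed

lemma vertex_list:
  assumes "pair_graph G"
  shows "distinct (vertex_list G)" "set (vertex_list G) = pverts G"
proof -
  interpret pair_graph G by (rule assms)
  have "\<exists>vs. distinct vs \<and> set vs = pverts G"
    using finite_distinct_list[OF pair_finite_verts] by blast
  from someI_ex[OF this] show "distinct (vertex_list G)" "set (vertex_list G) = pverts G"
    by (auto simp: vertex_list_def)
qed

lemma eigenvalue_adjacency_matrix_iff:
  assumes "pair_graph G" "distinct vs" "set vs = pverts G"
  shows "eigenvalue (adjacency_matrix G) k \<longleftrightarrow> eigenvalue (adjacency_matrix_wrt vs G) k"
  unfolding adjacency_matrix_def
  by (simp add: eigenvalue_adjacency_matrix_wrt_iff assms vertex_list)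

lemma pair_graph_A_graph:
  assumes "3 \<le> d" "d\<^sup>2 + d + 1 \<le> n"
  shows "pair_graph (A_graph n d)"
proof -
  have V: "pverts (A_graph n d) = insert Hub (\<Union>i<d. Cl i ` {..<clique_size n d i})"
    by (auto simp: A_graph_def)
  have fin: "finite (pverts (A_graph n d))" by (simp add: V)
  have pos: "0 < clique_size n d i" for i using assms by (simp add: clique_size_def)
  have sub: "parcs (A_graph n d) \<subseteq> pverts (A_graph n d) \<times> pverts (A_graph n d)"
    using pos by (auto simp: A_graph_def)
  show ?thesis
  proof
    show "finite (parcs (A_graph n d))" using sub fin finite_subset by blast
    show "symmetric (with_proj (A_graph n d))"
      unfolding symmetric_def sym_def by (auto simp: A_graph_def)
    show "fst e \<noteq> snd e" if "e \<in> parcs (A_graph n d)" for e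
      using that by (auto simp: A_graph_def)
  qed (use fin sub in auto)
qed

lemma card_A_graph:
  assumes "3 \<le> d" "d\<^sup>2 + d + 1 \<le> n"
  shows "card (pverts (A_graph n d)) = n"
proof -
  have V: "pverts (A_graph n d) = insert Hub (\<Union>i<d. Cl i ` {..<clique_size n d i})"
    by (auto simp: A_graph_def)
  obtain m where d: "d = Suc m" using assms(1) by (cases d) auto
  have "card (\<Union>i<d. Cl i ` {..<clique_size n d i}) = (\<Sum>i<d. card (Cl i ` {..<clique_size n d i}))"
    by (rule card_UN_disjoint) auto
  also have "\<dots> = (\<Sum>i<d. clique_size n d i)"
    by (intro sum.cong refl, subst card_image) (auto simp: inj_on_def)
  also have "\<dots> = n - d\<^sup>2 + m * (d + 1)"
    unfolding d by (subst sum.lessThan_Suc_shift) (simp add: clique_size_def)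
  also have "\<dots> + 1 = n" using assms(2) by (simp add: d power2_eq_square algebra_simps)
  finally have "card (\<Union>i<d. Cl i ` {..<clique_size n d i}) + 1 = n" .
  moreover have "Hub \<notin> (\<Union>i<d. Cl i ` {..<clique_size n d i})" by auto
  ultimately show ?thesis by (simp add: V)
qed

end

theory Submission
  imports Defs "HOL-Library.Disjoint_Sets" "Jordan_Normal_Form.Spectral_Radius"
begin

text \<open>
  The proof combines a structural and a spectral step. Let \<open>N = n - \<delta>\<^sup>2\<close>, the size of the large
  clique of \<open>A_graph n \<delta>\<close>.

  Structure. By the parity factor theorem of Lovasz, a graph without an even factor has a set \<open>T\<close> of
  vertices such that the number of parts outside \<open>T\<close> that send an odd number of edges to \<open>T\<close>
  exceeds the sum of \<open>deg v - 2\<close> over \<open>T\<close> (\<open>parity_barrier\<close>). With minimum degree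
  \<open>\<delta> \<ge> 3\<close> this yields \<open>\<delta>\<close> disjoint parts, each of which is attached to the rest by a
  single edge (\<open>pendant_parts\<close>). Each of these parts has at least \<open>\<delta> + 1\<close> vertices, and
  counting vertices leaves two possibilities (\<open>pendant_parts_dichotomy\<close>): all degrees are at most
  \<open>N - 1\<close>, or the graph embeds as a spanning subgraph into \<open>A_graph n \<delta>\<close>.

  Spectrum. The graph \<open>A_graph n \<delta>\<close> has an explicit positive eigenvector whose eigenvalue \<open>k\<close>
  exceeds \<open>N - 1\<close> (\<open>A_graph_positive_eigenvector\<close>). In the first case the spectral radius of
  the graph is at most the maximum degree, hence less than \<open>k\<close>. In the second case, comparison with
  the positive eigenvector shows that the spectral radius reaches \<open>k\<close> only if no edge is missing
  (\<open>eigenvalue_comparison\<close>). Either way the hypothesis on the spectral radius leaves only graphs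
  isomorphic to \<open>A_graph n \<delta>\<close>.

  The parity factor theorem is derived from the Tutte--Berge formula through a gadget graph whose perfect
  matchings correspond to even factors. The Tutte--Berge formula (\<open>Tutte_Berge_barrier\<close>) is proved by
  Gallai's argument: sets exposed by maximum matchings obey the basis exchange axiom, and the parallel
  classes of the resulting matroid are the odd sets of a barrier.
\<close>

section \<open>Maximum matchings and barriers\<close>

locale finite_graph =
  fixes V :: "'b set" and E :: "'b set set"
  assumes finite_V: "finite V"
    and edge_sub: "e \<in> E \<Longrightarrow> e \<subseteq> V"
    and edge_card: "e \<in> E \<Longrightarrow> card e = 2"
begin

definition matching :: "'b set set \<Rightarrow> bool" where
  "matching M \<longleftrightarrow> M \<subseteq> E \<and> disjoint M"

definition max_matching :: "'b set set \<Rightarrow> bool" where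
  "max_matching M \<longleftrightarrow> matching M \<and> (\<forall>M'. matching M' \<longrightarrow> card M' \<le> card M)"

lemma finite_E: "finite E"
  by (rule finite_subset[of _ "Pow V"]) (use edge_sub finite_V in auto)

lemma finite_matching: "matching M \<Longrightarrow> finite M"
  using finite_E finite_subset unfolding matching_def by blast

lemma finite_Union_matching: "matching M \<Longrightarrow> finite (\<Union>M)"
  and Union_matching_sub: "matching M \<Longrightarrow> \<Union>M \<subseteq> V"
proof -
  assume M: "matching M"
  show "\<Union>M \<subseteq> V" using M edge_sub unfolding matching_def by blast
  thus "finite (\<Union>M)" using finite_V finite_subset by blast
qed

lemma card_Union_edges: 
  assumes "matching M"
  shows "card (\<Union>M) = 2 * card M"
proof -
  have "card (\<Union>M) = sum card M"
  proof (rule card_Union_disjoint)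
    show "pairwise disjnt M" using assms by (simp add: matching_def disjoint_def pairwise_def disjnt_def)
    show "finite e" if "e \<in> M" for e
      using that assms edge_card[of e] by (intro card_ge_0_finite) (auto simp: matching_def)
  qed
  also have "\<dots> = sum (\<lambda>_. 2) M"
    by (rule sum.cong) (use assms edge_card in \<open>auto simp: matching_def\<close>)
  finally show ?thesis by simp
qed

lemma matching_subset: "matching M \<Longrightarrow> M' \<subseteq> M \<Longrightarrow> matching M'"
  unfolding matching_def disjoint_def by (meson order_trans subsetD)

lemma matching_insert:
  assumes "matching M" "{a, b} \<in> E" "a \<notin> \<Union>M" "b \<notin> \<Union>M"
  shows "matching (insert {a, b} M)" "card (insert {a, b} M) = Suc (card M)"
proof -
  show "matching (insert {a, b} M)"
    unfolding matching_def
  proof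
    show "insert {a, b} M \<subseteq> E" using assms by (simp add: matching_def)
    have "{a, b} \<inter> e = {}" if "e \<in> M" for e using assms(3,4) that by auto
    thus "disjoint (insert {a, b} M)" using assms(1)
      by (simp add: matching_def disjoint_def Int_commute)
  qed
  have "{a, b} \<notin> M" using assms(3) by auto
  thus "card (insert {a, b} M) = Suc (card M)" using finite_matching[OF assms(1)] by simp
qed

lemma max_matching_no_augment:
  assumes "max_matching M" "{a, b} \<in> E" "a \<notin> \<Union>M"
  shows "b \<in> \<Union>M"
proof (rule ccontr)
  assume "b \<notin> \<Union>M"
  hence "matching (insert {a, b} M)" "card (insert {a, b} M) = Suc (card M)"
    using assms matching_insert[of M a b] by (auto simp only: max_matching_def)
  thus False using assms(1) by (fastforce simp only: max_matching_def)
qed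

lemma edge_neq: "{a, b} \<in> E \<Longrightarrow> a \<noteq> b"
  using edge_card[of "{a, b}"] by auto

lemma edgeE:
  assumes "e \<in> E" "a \<in> e" obtains b where "e = {a, b}" "b \<noteq> a"
proof -
  obtain x y where "e = {x, y}" "x \<noteq> y" using edge_card[OF assms(1)] by (auto simp: card_2_iff)
  thus thesis using assms(2) that[of x] that[of y] by (auto simp: insert_commute)
qed

lemma matching_unique:
  "matching M \<Longrightarrow> {a, b} \<in> M \<Longrightarrow> {a, c} \<in> M \<Longrightarrow> b = c"
  unfolding matching_def disjoint_def by (metis disjoint_iff doubleton_eq_iff insertI1)

lemma matching_edge_unique:
  "matching M \<Longrightarrow> e \<in> M \<Longrightarrow> f \<in> M \<Longrightarrow> a \<in> e \<Longrightarrow> a \<in> f \<Longrightarrow> e = f"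
  unfolding matching_def disjoint_def by blast

text \<open>
  Replacing \<open>ab\<close> by \<open>bc\<close> keeps the size of a matching and moves the exposed
  vertex from \<open>c\<close> to \<open>a\<close>: one step of an alternating path.
\<close>

lemma matching_rotate:
  assumes M: "max_matching M" and ab: "{a, b} \<in> M" and bc: "{b, c} \<in> E" and c: "c \<notin> \<Union>M"
  defines "M' \<equiv> insert {b, c} (M - {{a, b}})"
  shows "max_matching M'" "\<Union>M' = insert c (\<Union>M - {a})"
proof -
  have mM: "matching M" using M by (simp add: max_matching_def)
  have neq: "a \<noteq> b" "b \<noteq> c" "a \<noteq> c" using ab bc c mM edge_neq by (auto simp: matching_def)
  have cov: "\<Union>(M - {{a, b}}) = \<Union>M - {a, b}"
    using matching_edge_unique[OF mM ab] by blast
  have m0: "matching (M - {{a, b}})" by (rule matching_subset[OF mM]) auto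
  have "matching M'" "card M' = Suc (card (M - {{a, b}}))"
    unfolding M'_def using matching_insert[OF m0 bc] c cov by auto
  moreover have "card M = Suc (card (M - {{a, b}}))"
    using ab finite_matching[OF mM] card_Suc_Diff1 by metis
  ultimately show "max_matching M'" using M by (auto simp: max_matching_def)
  show "\<Union>M' = insert c (\<Union>M - {a})" unfolding M'_def using cov ab neq by auto
qed

text \<open>
  The vertex sets exposed by maximum matchings satisfy the basis exchange axiom of a matroid: \<open>v\<close>,
  exposed by \<open>M2\<close>, can replace some vertex \<open>x\<close> exposed by \<open>M1\<close>. Usually one
  switches \<open>M1\<close> along an alternating path. The induction follows that path from \<open>v\<close>, two
  edges at a time, and rotates \<open>M2\<close> so that it agrees with \<open>M1\<close> on one more edge. The
  clause \<open>M1 \<inter> M2 \<subseteq> M3\<close> guarantees that the edges already passed are still there when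
  they are switched on the way back.
\<close>

lemma max_matching_exchange:
  assumes "max_matching M1" "max_matching M2" "v \<notin> \<Union>M2" "v \<in> \<Union>M1"
  shows "\<exists>M3 x. max_matching M3 \<and> M1 \<inter> M2 \<subseteq> M3 \<and> x \<in> V - \<Union>M1 \<and>
    \<Union>M3 = insert x (\<Union>M1 - {v})"
  using assms
proof (induction "card (M1 - M2)" arbitrary: M2 v rule: less_induct)
  case less
  note M1 = less.prems(1) and M2 = less.prems(2) and vM2 = less.prems(3)
  have m1: "matching M1" and m2: "matching M2" using M1 M2 by (auto simp: max_matching_def)
  obtain v1 where v1: "{v, v1} \<in> M1" "v1 \<noteq> v"
    using less.prems(4) edgeE m1 unfolding matching_def by (metis Union_iff subsetD)
  have e1: "{v, v1} \<in> E" using v1 m1 by (auto simp: matching_def)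
  have "v1 \<in> \<Union>M2" by (rule max_matching_no_augment[OF M2 e1 vM2])
  then obtain v2 where v2: "{v1, v2} \<in> M2" "v2 \<noteq> v1"
    using edgeE m2 unfolding matching_def by (metis Union_iff subsetD)
  have e2: "{v1, v2} \<in> E" using v2 m2 by (auto simp: matching_def)
  have v2v: "v2 \<noteq> v" using vM2 v2 by auto
  have v2V: "v2 \<in> V" using e2 edge_sub by blast
  define M2' where "M2' = insert {v1, v} (M2 - {{v2, v1}})"
  have M2': "max_matching M2'" "\<Union>M2' = insert v (\<Union>M2 - {v2})"
    unfolding M2'_def using matching_rotate[OF M2, of v2 v1 v] v2 e1 vM2 by (auto simp: insert_commute)
  have not21: "{v2, v1} \<notin> M1"
    using matching_unique[OF m1, of v1 v v2] v1 v2v by (auto simp: insert_commute)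
  have notv: "{v, v1} \<notin> M2" using vM2 by blast
  show ?case
  proof (cases "v2 \<in> \<Union>M1")
    case False
    have "max_matching (insert {v1, v2} (M1 - {{v, v1}}))"
      "\<Union>(insert {v1, v2} (M1 - {{v, v1}})) = insert v2 (\<Union>M1 - {v})"
      using matching_rotate[OF M1 v1(1) e2 False] by auto
    moreover have "M1 \<inter> M2 \<subseteq> insert {v1, v2} (M1 - {{v, v1}})" using notv by auto
    ultimately show ?thesis using False v2V by blast
  next
    case True
    have in2: "{v, v1} \<in> M2'" by (simp add: M2'_def insert_commute)
    have "{v, v1} \<in> M1 - M2" using v1(1) notv by simp
    moreover have "{v, v1} \<notin> M1 - M2'" using in2 by simp
    ultimately have "M1 - M2' \<noteq> M1 - M2" by metis
    moreover have "M1 - M2' \<subseteq> M1 - M2" using not21 by (auto simp only: M2'_def)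
    ultimately have "M1 - M2' \<subset> M1 - M2" by (rule psubsetI[rotated])
    hence "card (M1 - M2') < card (M1 - M2)"
      using finite_matching[OF m1] by (intro psubset_card_mono) auto
    moreover have "v2 \<notin> \<Union>M2'" using M2' v2v by auto
    ultimately obtain M3 x where M3: "max_matching M3" "M1 \<inter> M2' \<subseteq> M3" "x \<in> V - \<Union>M1"
      "\<Union>M3 = insert x (\<Union>M1 - {v2})"
      using less.hyps[OF _ M1 M2'(1) _ True] by blast
    have in3: "{v, v1} \<in> M3" using M3(2) v1(1) in2 by (meson IntI subsetD)
    have v23: "v2 \<notin> \<Union>M3" using M3 True by auto
    have "insert v2 (insert x (\<Union>M1 - {v2}) - {v}) = insert x (\<Union>M1 - {v})"
      using M3(3) True v2v less.prems(4) by fast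
    hence "\<Union>(insert {v1, v2} (M3 - {{v, v1}})) = insert x (\<Union>M1 - {v})"
      by (simp only: matching_rotate(2)[OF M3(1) in3 e2 v23] M3(4))
    moreover have "M1 \<inter> M2 \<subseteq> insert {v1, v2} (M3 - {{v, v1}})"
      using M3(2) notv not21 unfolding M2'_def by blast
    ultimately show ?thesis using M3(3) matching_rotate(1)[OF M3(1) in3 e2 v23] by blast
  qed
qed

lemma max_matching_exists: "\<exists>M. max_matching M"
proof -
  have fin: "finite (card ` {M. matching M})"
    by (rule finite_imageI, rule finite_subset[of _ "Pow E"]) (auto simp: matching_def finite_E)
  have "matching {}" by (simp add: matching_def)
  hence "Max (card ` {M. matching M}) \<in> card ` {M. matching M}" by (intro Max_in fin) blast
  then obtain M where "matching M" "card M = Max (card ` {M. matching M})" by auto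
  thus ?thesis using fin unfolding max_matching_def by (metis Max_ge imageI mem_Collect_eq)
qed

text \<open>
  The relation of being parallel in the matroid whose bases are the sets exposed by maximum matchings. If
  every vertex is exposed by some maximum matching, this matroid has no loops, and the relation is an
  equivalence.
\<close>

definition parallel :: "'b rel" where
  "parallel = {(u, v). u \<in> V \<and> v \<in> V \<and> (u = v \<or> (\<forall>M. max_matching M \<longrightarrow> u \<in> \<Union>M \<or> v \<in> \<Union>M))}"

lemma parallelD: "(u, v) \<in> parallel \<Longrightarrow> u \<noteq> v \<Longrightarrow> max_matching M \<Longrightarrow> u \<in> \<Union>M \<or> v \<in> \<Union>M"
  by (simp add: parallel_def)

text \<open>
  If \<open>u\<close> and \<open>w\<close> are exposed together by \<open>M1\<close>, exchanging in \<open>v\<close> evicts at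
  most one of them, so \<open>v\<close> is exposed together with the other one. This is Gallai's lemma in
  matroid form.
\<close>

lemma Gallai_transitive:
  assumes ess: "\<And>v. v \<in> V \<Longrightarrow> \<exists>M. max_matching M \<and> v \<notin> \<Union>M"
    and uv: "(u, v) \<in> parallel" and vw: "(v, w) \<in> parallel"
  shows "(u, w) \<in> parallel"
proof (rule ccontr)
  assume n: "(u, w) \<notin> parallel"
  have V: "u \<in> V" "v \<in> V" "w \<in> V" using uv vw by (auto simp: parallel_def)
  obtain M1 where M1: "max_matching M1" "u \<notin> \<Union>M1" "w \<notin> \<Union>M1" "u \<noteq> w"
    using n V by (auto simp: parallel_def)
  obtain M2 where M2: "max_matching M2" "v \<notin> \<Union>M2" using ess[OF V(2)] by blast
  have "u \<noteq> v" "w \<noteq> v" using n uv vw by auto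
  have v1: "v \<in> \<Union>M1" using parallelD[OF uv \<open>u \<noteq> v\<close> M1(1)] M1(2) by simp
  obtain M3 x where M3: "max_matching M3" "x \<in> V - \<Union>M1" "\<Union>M3 = insert x (\<Union>M1 - {v})"
    using max_matching_exchange[OF M1(1) M2 v1] by blast
  have "v \<notin> \<Union>M3" using M3(2,3) v1 by auto
  hence "u \<in> \<Union>M3" "w \<in> \<Union>M3"
    using parallelD[OF uv \<open>u \<noteq> v\<close> M3(1)] parallelD[OF vw \<open>w \<noteq> v\<close>[symmetric] M3(1)] by auto
  thus False using M1(2-4) M3(3) by simp
qed

text \<open>
  Adjacent vertices are parallel, since a maximum matching cannot expose both. Hence edges stay inside
  parallel classes and a maximum matching exposes at most one vertex of each class. As some maximum
  matching does expose a vertex of the class, the class is odd, and then every maximum matching exposes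
  exactly one of its vertices.
\<close>

lemma odd_barrier_of_all_inessential:
  assumes ess: "\<And>v. v \<in> V \<Longrightarrow> \<exists>M. max_matching M \<and> v \<notin> \<Union>M"
    and M: "max_matching M"
  shows "\<exists>P. disjoint P \<and> (\<forall>K\<in>P. K \<subseteq> V \<and> odd (card K) \<and> (\<forall>e\<in>E. e \<inter> K \<noteq> {} \<longrightarrow> e \<subseteq> K)) \<and>
    card P = card (V - \<Union>M)"
proof -
  have eq: "equiv V parallel"
  proof (rule equivI)
    show "trans parallel" by (rule transI) (rule Gallai_transitive[OF ess])
  qed (auto simp: parallel_def refl_on_def sym_def)
  have adj: "(a, b) \<in> parallel" if "{a, b} \<in> E" for a b
    using that max_matching_no_augment[of _ a b] edge_sub[OF that] by (auto simp: parallel_def)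
  have cls1: "K \<subseteq> V" and cls2: "K \<noteq> {}" if "K \<in> V // parallel" for K
    using in_quotient_imp_subset[OF eq that] in_quotient_imp_non_empty[OF eq that] by blast+
  have cls3: "(a, b) \<in> parallel" if "K \<in> V // parallel" "a \<in> K" "b \<in> K" for K a b
    using quotient_eq_iff[OF eq that(1) that(1) that(2,3)] by blast
  have cls4: "b \<in> K" if "K \<in> V // parallel" "a \<in> K" "(a, b) \<in> parallel" for K a b
    using in_quotient_imp_closed[OF eq that] .
  have closed: "e \<subseteq> K" if K: "K \<in> V // parallel" and e: "e \<in> E" "e \<inter> K \<noteq> {}" for K e
  proof -
    obtain a where a: "a \<in> e" "a \<in> K" using e by blast
    obtain b where b: "e = {a, b}" using edgeE[OF e(1) a(1)] by blast
    show ?thesis using a(2) b cls4[OF K a(2) adj] e(1) by auto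
  qed
  have even_cov: "even (card (K \<inter> \<Union>M'))" if K: "K \<in> V // parallel" and M': "max_matching M'" for K M'
  proof -
    have m': "matching M'" using M' by (simp add: max_matching_def)
    have "K \<inter> \<Union>M' = \<Union>{e\<in>M'. e \<inter> K \<noteq> {}}"
      using closed[OF K] m' unfolding matching_def by blast
    moreover have "matching {e\<in>M'. e \<inter> K \<noteq> {}}" by (rule matching_subset[OF m']) auto
    ultimately show ?thesis using card_Union_edges by simp
  qed
  have split: "card K = card (K \<inter> \<Union>M') + card (K - \<Union>M')" if "K \<in> V // parallel" for K M'
    using card_Diff_subset_Int[of K "\<Union>M'"] finite_subset[OF cls1[OF that] finite_V]
    by (metis card_Int_Diff)
  have le1: "a = b" if K: "K \<in> V // parallel" and M': "max_matching M'" and "a \<in> K - \<Union>M'" "b \<in> K - \<Union>M'"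
    for K M' a b
    using parallelD[OF cls3[OF K] _ M', of a b] that by blast
  have odd: "odd (card K)" if K: "K \<in> V // parallel" for K
  proof -
    obtain a where a: "a \<in> K" using cls2[OF K] by blast
    then obtain M' where M': "max_matching M'" "a \<notin> \<Union>M'" using ess cls1[OF K] by blast
    have "K - \<Union>M' = {a}" using le1[OF K M'(1)] a M'(2) by blast
    thus ?thesis using split[OF K, of M'] even_cov[OF K M'(1)] by simp
  qed
  have ex1: "\<exists>a. K - \<Union>M = {a}" if K: "K \<in> V // parallel" for K
  proof -
    have "K - \<Union>M \<noteq> {}"
    proof
      assume "K - \<Union>M = {}"
      hence "card (K - \<Union>M) = 0" by (simp only: card.empty)
      thus False using split[OF K, of M] odd[OF K] even_cov[OF K M] by simp
    qed
    thus ?thesis using le1[OF K M] by blast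
  qed
  have "bij_betw (\<lambda>a. parallel `` {a}) (V - \<Union>M) (V // parallel)"
    unfolding bij_betw_def
  proof
    show "inj_on (\<lambda>a. parallel `` {a}) (V - \<Union>M)"
    proof (rule inj_onI)
      fix a b assume ab: "a \<in> V - \<Union>M" "b \<in> V - \<Union>M" "parallel `` {a} = parallel `` {b}"
      hence "(a, b) \<in> parallel" using eq_equiv_class[OF ab(3) eq] by blast
      thus "a = b" using ab(1,2) parallelD[OF _ _ M, of a b] by blast
    qed
    show "(\<lambda>a. parallel `` {a}) ` (V - \<Union>M) = V // parallel"
    proof (intro equalityI subsetI)
      fix K assume "K \<in> (\<lambda>a. parallel `` {a}) ` (V - \<Union>M)"
      thus "K \<in> V // parallel" by (auto intro: quotientI)
    next
      fix K assume K: "K \<in> V // parallel"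
      obtain a where a: "K - \<Union>M = {a}" using ex1[OF K] by blast
      hence aK: "a \<in> K" by blast
      have "parallel `` {a} = K" using cls3[OF K] cls4[OF K] aK by blast
      moreover have "a \<in> V - \<Union>M" using a cls1[OF K] by blast
      ultimately show "K \<in> (\<lambda>a. parallel `` {a}) ` (V - \<Union>M)" by blast
    qed
  qed
  hence "card (V - \<Union>M) = card (V // parallel)" by (rule bij_betw_same_card)
  moreover have "disjoint (V // parallel)"
    using quotient_disj[OF eq] by (auto simp: disjoint_def)
  ultimately show ?thesis
    using cls1 odd closed by (intro exI[of _ "V // parallel"]) auto
qed

end

text \<open>
  A barrier in the sense of Tutte, with the odd components of \<open>V - S\<close> replaced by arbitrary
  disjoint odd sets that no edge of \<open>V - S\<close> leaves. Each such set contains an odd component, so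
  nothing is lost, and no notion of connectedness is required.
\<close>

definition odd_barrier :: "'b set \<Rightarrow> 'b set set \<Rightarrow> 'b set \<Rightarrow> 'b set set \<Rightarrow> bool" where
  "odd_barrier V E S P \<longleftrightarrow> S \<subseteq> V \<and> disjoint P \<and>
     (\<forall>K\<in>P. K \<subseteq> V - S \<and> odd (card K) \<and> (\<forall>e\<in>E. e \<inter> K \<noteq> {} \<longrightarrow> e \<subseteq> K \<union> S))"

text \<open>
  The difficult half of the Tutte--Berge formula. A vertex that is covered by all maximum matchings is
  moved into \<open>S\<close>; deleting it raises the number of exposed vertices by one. If there is no such
  vertex, the parallel classes are a barrier with \<open>S = {}\<close>.
\<close>

lemma Tutte_Berge_barrier:
  assumes "finite_graph V E" "finite_graph.max_matching E M"
  shows "\<exists>S P. odd_barrier V E S P \<and> card P = card S + card (V - \<Union>M)"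
  using assms
proof (induction "card V" arbitrary: V E M rule: less_induct)
  case less
  interpret finite_graph V E by (rule less.prems)
  have M: "max_matching M" by (rule less.prems)
  show ?case
  proof (cases "\<forall>v\<in>V. \<exists>M. max_matching M \<and> v \<notin> \<Union>M")
    case True
    then obtain P where "disjoint P" "card P = card (V - \<Union>M)"
      "\<forall>K\<in>P. K \<subseteq> V \<and> odd (card K) \<and> (\<forall>e\<in>E. e \<inter> K \<noteq> {} \<longrightarrow> e \<subseteq> K)"
      using odd_barrier_of_all_inessential[OF _ M] by metis
    thus ?thesis by (intro exI[of _ "{}"] exI[of _ P]) (auto simp: odd_barrier_def)
  next
    case False
    then obtain v where v: "v \<in> V" "\<And>M. max_matching M \<Longrightarrow> v \<in> \<Union>M" by blast
    define V' where "V' = V - {v}"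
    define E' where "E' = {e\<in>E. v \<notin> e}"
    interpret G': finite_graph V' E'
      by standard (use finite_V edge_sub edge_card in \<open>auto simp: V'_def E'_def\<close>)
    have m: "matching M" using M by (simp add: max_matching_def)
    obtain e where e: "e \<in> M" "v \<in> e" using v(2)[OF M] by blast
    define M' where "M' = M - {e}"
    have cM: "card M = Suc (card M')"
      unfolding M'_def using e finite_matching[OF m] card_Suc_Diff1 by metis
    have le: "card N \<le> card M'" if N: "G'.matching N" for N
    proof (rule ccontr)
      assume "\<not> card N \<le> card M'"
      hence c: "card M \<le> card N" using cM by simp
      have N': "N \<subseteq> E'" "disjoint N" using N by (auto simp: G'.matching_def)
      hence "matching N" by (auto simp: matching_def E'_def)
      hence "max_matching N" using c M unfolding max_matching_def by (meson order_trans)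
      hence "v \<in> \<Union>N" by (rule v(2))
      thus False using N' by (auto simp: E'_def)
    qed
    have "v \<notin> f" if "f \<in> M'" for f
      using matching_edge_unique[OF m e(1) _ e(2)] that by (auto simp: M'_def)
    moreover have "M' \<subseteq> E" "disjoint M'"
      using matching_subset[OF m, of M'] by (auto simp: matching_def M'_def)
    ultimately have "M' \<subseteq> E'" "disjoint M'" by (auto simp: E'_def)
    hence "G'.matching M'" by (simp add: G'.matching_def)
    hence mM': "G'.max_matching M'" using le by (simp add: G'.max_matching_def)
    have "card V' < card V" using v(1) finite_V unfolding V'_def by (rule card_Diff1_less[rotated])
    then obtain S P where SP: "odd_barrier V' E' S P" "card P = card S + card (V' - \<Union>M')"
      using less.hyps[OF _ G'.finite_graph_axioms mM'] by blast
    have cov: "\<Union>M' = \<Union>M - e"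
      using matching_edge_unique[OF m e(1)] unfolding M'_def by blast
    have eV: "e \<subseteq> \<Union>M" "e \<subseteq> V" "card e = 2" using e m edge_sub edge_card by (auto simp: matching_def)
    have "V' - \<Union>M' = (V - \<Union>M) \<union> (e - {v})" unfolding V'_def cov using eV e v by blast
    moreover have "card ((V - \<Union>M) \<union> (e - {v})) = card (V - \<Union>M) + card (e - {v})"
      using finite_V eV finite_subset[OF eV(2)] by (intro card_Un_disjoint) auto
    moreover have "card (e - {v}) = 1" using e eV by simp
    ultimately have c1: "card (V' - \<Union>M') = card (V - \<Union>M) + 1" by simp
    have vS: "v \<notin> S" "finite S" using SP(1) finite_V finite_subset unfolding odd_barrier_def V'_def by blast+
    have "odd_barrier V E (insert v S) P"
      unfolding odd_barrier_def
    proof (intro conjI ballI impI)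
      show "insert v S \<subseteq> V" "disjoint P" using SP(1) v(1) by (auto simp: odd_barrier_def V'_def)
      fix K assume K: "K \<in> P"
      show "K \<subseteq> V - insert v S" "odd (card K)" using SP(1) K by (auto simp: odd_barrier_def V'_def)
      fix f assume f: "f \<in> E" "f \<inter> K \<noteq> {}"
      show "f \<subseteq> K \<union> insert v S"
      proof (cases "v \<in> f")
        case True
        then obtain b where "f = {v, b}" using edgeE[OF f(1)] by blast
        moreover have "v \<notin> K" using SP(1) K by (auto simp: odd_barrier_def V'_def)
        ultimately show ?thesis using f by auto
      next
        case False
        hence "f \<in> E'" using f by (simp add: E'_def)
        thus ?thesis using SP(1) K f(2) unfolding odd_barrier_def by blast
      qed
    qed
    moreover have "card P = card (insert v S) + card (V - \<Union>M)"
      using SP(2) c1 vS by simp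
    ultimately show ?thesis by blast
  qed
qed

text \<open>
  A vertex \<open>s\<close> whose neighbours outside \<open>S\<close> lie in two sets \<open>X\<close>, \<open>Y\<close>, each of
  which is not split by \<open>P\<close>, can be released from \<open>S\<close> at the cost of one odd set. If
  \<open>X\<close> and \<open>Y\<close> lie in different odd sets, these merge with \<open>s\<close> into one set, which is
  odd again; otherwise at most one odd set touches \<open>s\<close>, and it is discarded.
\<close>

lemma barrier_shrink:
  assumes "finite_graph V E" and SP: "odd_barrier V E S P" and s: "s \<in> S"
    and X: "\<And>K. K \<in> P \<Longrightarrow> K \<inter> X \<noteq> {} \<Longrightarrow> X \<subseteq> K"
    and Y: "\<And>K. K \<in> P \<Longrightarrow> K \<inter> Y \<noteq> {} \<Longrightarrow> Y \<subseteq> K"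
    and nb: "\<And>y. {s, y} \<in> E \<Longrightarrow> y \<in> S \<union> X \<union> Y"
  shows "\<exists>P'. odd_barrier V E (S - {s}) P' \<and> card P \<le> card P' + 1"
proof -
  interpret finite_graph V E by fact
  have P: "S \<subseteq> V" "disjoint P" "\<And>K. K \<in> P \<Longrightarrow> K \<subseteq> V - S" "\<And>K. K \<in> P \<Longrightarrow> odd (card K)"
    "\<And>K e. K \<in> P \<Longrightarrow> e \<in> E \<Longrightarrow> e \<inter> K \<noteq> {} \<Longrightarrow> e \<subseteq> K \<union> S"
    using SP by (auto simp only: odd_barrier_def)
  have finP: "finite P" by (rule finite_subset[of _ "Pow V"]) (use P(3) finite_V in auto)
  have uniq: "K = L" if "K \<in> P" "L \<in> P" "x \<in> K" "x \<in> L" for K L x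
    using P(2) that unfolding disjoint_def by blast
  have sK: "s \<notin> K" if "K \<in> P" for K using P(3)[OF that] s by blast
  have far: "e \<subseteq> K \<union> (S - {s})" if K: "K \<in> P" "K \<inter> X = {}" "K \<inter> Y = {}" and e: "e \<in> E" "e \<inter> K \<noteq> {}" for K e
  proof -
    have "s \<notin> e"
    proof
      assume "s \<in> e"
      then obtain y where y: "e = {s, y}" using edgeE[OF e(1)] by blast
      hence "y \<in> K" using e(2) sK[OF K(1)] by auto
      moreover have "y \<in> S \<union> X \<union> Y" using nb e(1) y by simp
      ultimately show False using K P(3)[OF K(1)] by blast
    qed
    thus ?thesis using P(5)[OF K(1) e] by blast
  qed
  show ?thesis
  proof (cases "\<exists>K\<in>P. \<exists>L\<in>P. K \<noteq> L \<and> K \<inter> X \<noteq> {} \<and> L \<inter> Y \<noteq> {}")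
    case True
    then obtain K L where KL: "K \<in> P" "L \<in> P" "K \<noteq> L" "K \<inter> X \<noteq> {}" "L \<inter> Y \<noteq> {}" by blast
    have XK: "X \<subseteq> K" and YL: "Y \<subseteq> L" using X Y KL by auto
    have KLd: "K \<inter> L = {}" using uniq[OF KL(1,2)] KL(3) by blast
    define N where "N = insert s (K \<union> L)"
    have fin: "finite K" "finite L" using P(3) KL finite_V finite_subset by blast+
    have "card N = card K + card L + 1"
      unfolding N_def using fin KLd sK[OF KL(1)] sK[OF KL(2)] by (simp add: card_Un_disjoint)
    hence odd: "odd (card N)" using P(4) KL by simp
    have Nd: "N \<inter> M = {}" if "M \<in> P - {K, L}" for M
      using that uniq[OF KL(1), of M] uniq[OF KL(2), of M] sK[of M] unfolding N_def by blast
    have "N \<notin> P" using sK unfolding N_def by blast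
    hence "card (insert N (P - {K, L})) = Suc (card (P - {K, L}))" using finP by simp
    moreover have "card P = card (P - {K, L}) + 2"
      using card_Diff_subset[of "{K, L}" P] KL card_mono[OF finP, of "{K, L}"] by simp
    ultimately have c: "card P \<le> card (insert N (P - {K, L})) + 1" by simp
    have "odd_barrier V E (S - {s}) (insert N (P - {K, L}))"
      unfolding odd_barrier_def
    proof (intro conjI ballI impI)
      show "S - {s} \<subseteq> V" using P(1) by blast
      have "disjoint (P - {K, L})" using P(2) by (simp add: disjoint_def)
      thus "disjoint (insert N (P - {K, L}))" using Nd by (auto simp: disjoint_def)
      fix M assume M: "M \<in> insert N (P - {K, L})"
      show "M \<subseteq> V - (S - {s})"
        using M P(3)[of M] P(3)[OF KL(1)] P(3)[OF KL(2)] s P(1) unfolding N_def by blast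
      show "odd (card M)" using M odd P(4) by auto
      fix e assume e: "e \<in> E" "e \<inter> M \<noteq> {}"
      show "e \<subseteq> M \<union> (S - {s})"
      proof (cases "M = N")
        case False
        hence "M \<in> P" "M \<noteq> K" "M \<noteq> L" using M by auto
        thus ?thesis using far[of M e] e XK YL uniq[OF KL(1), of M] uniq[OF KL(2), of M] by blast
      next
        case True
        show ?thesis
        proof (cases "e \<inter> K \<noteq> {} \<or> e \<inter> L \<noteq> {}")
          case True
          thus ?thesis using P(5)[OF KL(1) e(1)] P(5)[OF KL(2) e(1)] \<open>M = N\<close> unfolding N_def by blast
        next
          case False
          hence "s \<in> e" using e(2) \<open>M = N\<close> unfolding N_def by blast
          then obtain y where y: "e = {s, y}" using edgeE[OF e(1)] by blast
          thus ?thesis using nb[of y] e(1) XK YL \<open>M = N\<close> unfolding N_def by auto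
        qed
      qed
    qed
    thus ?thesis using c by blast
  next
    case False
    define D where "D = {K \<in> P. K \<inter> X \<noteq> {} \<or> K \<inter> Y \<noteq> {}}"
    have "K = L" if "K \<in> D" "L \<in> D" for K L
    proof -
      have "K \<in> P" "L \<in> P" using that by (auto simp: D_def)
      have "K = L" if "K \<inter> X \<noteq> {}" "L \<inter> X \<noteq> {}"
        using that X[OF \<open>K \<in> P\<close>] X[OF \<open>L \<in> P\<close>] uniq[OF \<open>K \<in> P\<close> \<open>L \<in> P\<close>] by blast
      moreover have "K = L" if "K \<inter> Y \<noteq> {}" "L \<inter> Y \<noteq> {}"
        using that Y[OF \<open>K \<in> P\<close>] Y[OF \<open>L \<in> P\<close>] uniq[OF \<open>K \<in> P\<close> \<open>L \<in> P\<close>] by blast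
      ultimately show ?thesis using False that unfolding D_def by blast
    qed
    moreover have D: "finite D" "D \<subseteq> P" using finP by (auto simp: D_def)
    ultimately have "card D \<le> 1" using card_le_Suc0_iff_eq[OF D(1)] unfolding One_nat_def by blast
    moreover have "card P = card (P - D) + card D"
      using card_Diff_subset[OF D] card_mono[OF finP D(2)] by simp
    ultimately have c: "card P \<le> card (P - D) + 1" by simp
    have "odd_barrier V E (S - {s}) (P - D)"
      unfolding odd_barrier_def
    proof (intro conjI ballI impI)
      show "S - {s} \<subseteq> V" using P(1) by blast
      show "disjoint (P - D)" using P(2) by (simp add: disjoint_def)
      fix M assume M: "M \<in> P - D"
      show "M \<subseteq> V - (S - {s})" "odd (card M)" using M P(3)[of M] P(4)[of M] by auto
      fix e assume "e \<in> E" "e \<inter> M \<noteq> {}"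
      thus "e \<subseteq> M \<union> (S - {s})" using far[of M e] M unfolding D_def by blast
    qed
    thus ?thesis using c by blast
  qed
qed

section \<open>Even factors as perfect matchings of a gadget graph\<close>

text \<open>
  The handshake lemma: arcs come in pairs of opposite arcs.
\<close>

lemma even_card_sym_irrefl:
  assumes "finite R" "sym R" "irrefl R"
  shows "even (card R)"
  using assms
proof (induction R rule: finite_psubset_induct)
  case (psubset R)
  show ?case
  proof (cases "R = {}")
    case False
    then obtain a b where ab: "(a, b) \<in> R" by auto
    have ba: "(b, a) \<in> R" "a \<noteq> b" using ab psubset.prems by (auto simp: sym_def irrefl_def)
    define R' where "R' = R - {(a, b), (b, a)}"
    have "even (card R')"
    proof (rule psubset.IH)
      show "R' \<subset> R" using ab by (auto simp: R'_def)
      show "sym R'" "irrefl R'" using psubset.prems by (auto simp: R'_def sym_def irrefl_def)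
    qed
    moreover have "card R = card R' + 2"
      using card_Diff_subset[of "{(a, b), (b, a)}" R] ab ba psubset.hyps
        card_mono[of R "{(a, b), (b, a)}"] by (simp add: R'_def)
    ultimately show ?thesis by simp
  qed simp
qed

lemma card_meeting_le:
  assumes "disjoint P" "finite X" "\<And>K. K \<in> P \<Longrightarrow> K \<inter> X \<noteq> {}"
  shows "card P \<le> card X"
proof -
  define pick where "pick K = (SOME x. x \<in> K \<inter> X)" for K
  have pick: "pick K \<in> K" "pick K \<in> X" if "K \<in> P" for K
    using someI_ex[of "\<lambda>x. x \<in> K \<inter> X"] assms(3)[OF that] unfolding pick_def by blast+
  have "inj_on pick P"
  proof (rule inj_onI)
    fix K L assume KL: "K \<in> P" "L \<in> P" "pick K = pick L"
    hence "pick K \<in> K \<inter> L" using pick(1)[OF KL(1)] pick(1)[OF KL(2)] by simp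
    thus "K = L" using assms(1) KL(1,2) unfolding disjoint_def by blast
  qed
  moreover have "pick ` P \<subseteq> X" using pick by blast
  ultimately show ?thesis using assms(2) card_inj_on_le by blast
qed

locale sym_arcs =
  fixes V :: "'a set" and A :: "'a rel"
  assumes finite_verts: "finite V" and arcs_sub: "A \<subseteq> V \<times> V" and sym_A: "sym A" and irrefl_A: "irrefl A"
begin

definition deg :: "'a \<Rightarrow> nat" where "deg v = card (A `` {v})"

lemma finite_A: "finite A" using finite_verts arcs_sub finite_subset by blast

lemma A_swap: "(v, w) \<in> A \<Longrightarrow> (w, v) \<in> A" using sym_A by (auto simp: sym_def)

lemma A_V: "(v, w) \<in> A \<Longrightarrow> v \<in> V" "(v, w) \<in> A \<Longrightarrow> w \<in> V" using arcs_sub by auto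

lemma A_neq: "(v, w) \<in> A \<Longrightarrow> v \<noteq> w" using irrefl_A by (auto simp: irrefl_def)

lemma finite_nbrs: "finite (A `` {v})"
  by (rule finite_subset[OF _ finite_verts]) (use A_V in auto)

lemma sum_deg: assumes "T \<subseteq> V" shows "(\<Sum>v\<in>T. deg v) = card {(v, w) \<in> A. v \<in> T}"
proof -
  have "{(v, w) \<in> A. v \<in> T} = Sigma T (\<lambda>v. A `` {v})" by auto
  thus ?thesis using finite_subset[OF assms finite_verts] finite_nbrs by (simp add: deg_def)
qed

text \<open>
  In the gadget graph an arc \<open>(v, w)\<close> stands for the end at \<open>v\<close> of the edge \<open>vw\<close>, and
  each vertex owns two further vertices. The ends and the two extra vertices owned by \<open>v\<close> form a
  complete graph, except that the extra vertices are not adjacent to each other. The two ends of an edge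
  are also adjacent; a perfect matching uses this cross edge iff the edge is left out of the factor. The
  extra vertices have to be matched to two ends, and the remaining ends at \<open>v\<close> that belong to the
  factor are matched in pairs: the degree is even and at least \<open>2\<close>.
\<close>

definition gadget_verts :: "('a \<times> 'a + 'a \<times> bool) set" where
  "gadget_verts = Inl ` A \<union> Inr ` (V \<times> UNIV)"

definition gadget_edges :: "('a \<times> 'a + 'a \<times> bool) set set" where
  "gadget_edges = {{Inl (v, w), Inl (w, v)} | v w. (v, w) \<in> A}
      \<union> {{Inl (v, w), Inl (v, w')} | v w w'. (v, w) \<in> A \<and> (v, w') \<in> A \<and> w \<noteq> w'}
      \<union> {{Inl (v, w), Inr (v, b)} | v w b. (v, w) \<in> A}"

fun owner :: "'a \<times> 'a + 'a \<times> bool \<Rightarrow> 'a" where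
  "owner (Inl (v, w)) = v" | "owner (Inr (v, b)) = v"

sublocale gadget: finite_graph gadget_verts gadget_edges
proof
  show "finite gadget_verts" using finite_A finite_verts by (simp add: gadget_verts_def)
  fix e assume "e \<in> gadget_edges"
  thus "e \<subseteq> gadget_verts" "card e = 2"
    using A_swap A_V A_neq unfolding gadget_edges_def gadget_verts_def by (auto simp: card_insert_if)
qed

lemma cross_edge: "(v, w) \<in> A \<Longrightarrow> {Inl (v, w), Inl (w, v)} \<in> gadget_edges"
  unfolding gadget_edges_def by blast

lemma end_adjacent:
  assumes vw: "(v, w) \<in> A" and y: "y \<in> gadget_verts" "owner y = v" "y \<noteq> Inl (v, w)"
  shows "{Inl (v, w), y} \<in> gadget_edges"
proof (cases y)
  case (Inl p)
  then obtain w' where "y = Inl (v, w')" "(v, w') \<in> A" "w \<noteq> w'"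
    using y by (cases p) (auto simp: gadget_verts_def)
  thus ?thesis using vw unfolding gadget_edges_def by blast
next
  case (Inr p)
  then obtain b where "y = Inr (v, b)" using y by (cases p) auto
  thus ?thesis using vw unfolding gadget_edges_def by blast
qed

lemma gadget_edge_cases:
  assumes "e \<in> gadget_edges"
  obtains (cross) v w where "(v, w) \<in> A" "e = {Inl (v, w), Inl (w, v)}"
    | (inner) v w where "(v, w) \<in> A" "Inl (v, w) \<in> e" "\<And>x. x \<in> e \<Longrightarrow> owner x = v"
proof -
  consider (1) v w where "(v, w) \<in> A" "e = {Inl (v, w), Inl (w, v)}"
    | (2) v w w' where "(v, w) \<in> A" "e = {Inl (v, w), Inl (v, w')}"
    | (3) v w b where "(v, w) \<in> A" "e = {Inl (v, w), Inr (v, b)}"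
    using assms unfolding gadget_edges_def by blast
  thus thesis
  proof cases
    case 1 thus thesis by (rule that(1))
  next
    case 2 show thesis by (rule that(2)[OF 2(1)]) (auto simp: 2(2))
  next
    case 3 show thesis by (rule that(2)[OF 3(1)]) (auto simp: 3(2))
  qed
qed

lemma owner_in_V: "x \<in> gadget_verts \<Longrightarrow> owner x \<in> V"
  using A_V by (auto simp: gadget_verts_def)

lemma even_factor_of_perfect_matching:
  assumes M: "gadget.matching M" and perf: "\<Union>M = gadget_verts"
  shows "\<exists>F\<subseteq>A. sym F \<and> (\<forall>v\<in>V. even (card (F `` {v})) \<and> F `` {v} \<noteq> {})"
proof -
  define F where "F = {(v, w) \<in> A. {Inl (v, w), Inl (w, v)} \<notin> M}"
  have "sym F" unfolding F_def sym_def using A_swap by (auto simp: insert_commute)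
  moreover have "even (card (F `` {v})) \<and> F `` {v} \<noteq> {}" if v: "v \<in> V" for v
  proof -
    define Mv where "Mv = {e \<in> M. \<forall>x\<in>e. owner x = v}"
    have cov: "\<Union>Mv = Inl ` ({v} \<times> F `` {v}) \<union> {Inr (v, True), Inr (v, False)}" (is "_ = ?R")
    proof (intro equalityI subsetI)
      fix x assume "x \<in> \<Union>Mv"
      then obtain e where e: "e \<in> M" "x \<in> e" "\<forall>x\<in>e. owner x = v" by (auto simp: Mv_def)
      have xG: "x \<in> gadget_verts" using e(1,2) perf by blast
      show "x \<in> ?R"
      proof (cases x)
        case (Inr p)
        thus ?thesis using e by (cases p) auto
      next
        case (Inl p)
        then obtain w where x: "x = Inl (v, w)" using e by (cases p) auto
        hence vw: "(v, w) \<in> A" using xG by (auto simp: gadget_verts_def)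
        have "{Inl (v, w), Inl (w, v)} \<notin> M"
        proof
          assume m: "{Inl (v, w), Inl (w, v)} \<in> M"
          have "{Inl (v, w), Inl (w, v)} = e"
            using gadget.matching_edge_unique[OF M m e(1), of x] x e(2) by simp
          hence "owner (Inl (w, v)) = v" using e(3) by blast
          thus False using A_neq[OF vw] by simp
        qed
        thus ?thesis using x vw by (auto simp: F_def)
      qed
    next
      fix x assume x: "x \<in> ?R"
      have xG: "x \<in> gadget_verts" using x v by (auto simp: gadget_verts_def F_def)
      have ox: "owner x = v" using x by auto
      obtain e where e: "e \<in> M" "x \<in> e" using xG perf by blast
      have eG: "e \<in> gadget_edges" using e(1) M by (auto simp: gadget.matching_def)
      show "x \<in> \<Union>Mv" using eG
      proof (cases rule: gadget_edge_cases)
        case (cross u w)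
        hence "x = Inl (u, w) \<or> x = Inl (w, u)" using e(2) by auto
        hence "x \<notin> ?R" using e(1) cross by (auto simp: F_def insert_commute)
        thus ?thesis using x by blast
      next
        case (inner u w)
        hence "u = v" using e(2) ox by blast
        thus ?thesis using e inner(3) unfolding Mv_def by blast
      qed
    qed
    have "gadget.matching Mv" by (rule gadget.matching_subset[OF M]) (auto simp: Mv_def)
    hence "even (card ?R)" using gadget.card_Union_edges[of Mv] unfolding cov by simp
    moreover have finF: "finite (F `` {v})"
      by (rule finite_subset[OF _ finite_nbrs[of v]]) (auto simp: F_def)
    hence "card ?R = card (F `` {v}) + 2"
      by (subst card_Un_disjoint) (auto simp: card_image card_cartesian_product inj_on_def)
    ultimately have "even (card (F `` {v}))" by simp
    moreover have "F `` {v} \<noteq> {}"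
    proof -
      have "Inr (v, True) \<in> \<Union>Mv" using cov by blast
      then obtain e where e: "e \<in> Mv" "Inr (v, True) \<in> e" by blast
      have "e \<in> gadget_edges" using e(1) M by (auto simp: gadget.matching_def Mv_def)
      thus ?thesis
      proof (cases rule: gadget_edge_cases)
        case (inner u w)
        have "u = v" using inner(3)[OF e(2)] by simp
        hence "Inl (v, w) \<in> ?R" using cov e(1) inner(2) by blast
        thus ?thesis by auto
      qed (use e(2) in auto)
    qed
    ultimately show ?thesis ..
  qed
  moreover have "F \<subseteq> A" by (auto simp: F_def)
  ultimately show ?thesis by blast
qed

lemma even_card_gadget_verts: "even (card gadget_verts)"
proof -
  have "card gadget_verts = card A + card (V \<times> (UNIV :: bool set))"
    unfolding gadget_verts_def using finite_A finite_verts
    by (subst card_Un_disjoint) (auto simp: card_image)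
  thus ?thesis using even_card_sym_irrefl[OF finite_A sym_A irrefl_A] by (simp add: card_cartesian_product)
qed

text \<open>
  The gadget graph has an even number of vertices, so a maximum matching that is not perfect exposes at
  least two of them.
\<close>

lemma gadget_barrier:
  assumes no: "\<nexists>F. F \<subseteq> A \<and> sym F \<and> (\<forall>v\<in>V. even (card (F `` {v})) \<and> F `` {v} \<noteq> {})"
  shows "\<exists>S P. odd_barrier gadget_verts gadget_edges S P \<and> card S + 2 \<le> card P"
proof -
  obtain M where M: "gadget.max_matching M" using gadget.max_matching_exists by blast
  hence m: "gadget.matching M" by (simp add: gadget.max_matching_def)
  have "\<Union>M \<noteq> gadget_verts" using even_factor_of_perfect_matching[OF m] no by blast
  hence "gadget_verts - \<Union>M \<noteq> {}" using gadget.Union_matching_sub[OF m] by blast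
  hence "card (gadget_verts - \<Union>M) > 0" using gadget.finite_V by (simp add: card_gt_0_iff)
  moreover have "even (card (gadget_verts - \<Union>M))"
    using even_card_gadget_verts gadget.card_Union_edges[OF m] gadget.Union_matching_sub[OF m]
      gadget.finite_Union_matching[OF m] by (simp add: card_Diff_subset)
  ultimately have "card (gadget_verts - \<Union>M) \<ge> 2" by presburger
  thus ?thesis using Tutte_Berge_barrier[OF gadget.finite_graph_axioms M] by fastforce
qed

text \<open>
  In a barrier with \<open>S\<close> as small as possible, \<open>barrier_shrink\<close> never applies. An extra
  vertex has its neighbours in one complete graph, so it is not in \<open>S\<close>. An end at \<open>v\<close> has
  one neighbour across and all others in the gadget of \<open>v\<close>, which is indivisible as long as one end
  at \<open>v\<close> is outside \<open>S\<close>. So \<open>S\<close> contains either all ends at \<open>v\<close> or none.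
\<close>

lemma gadget_barrier_full_ends:
  assumes no: "\<nexists>F. F \<subseteq> A \<and> sym F \<and> (\<forall>v\<in>V. even (card (F `` {v})) \<and> F `` {v} \<noteq> {})"
  shows "\<exists>T P. T \<subseteq> V \<and> odd_barrier gadget_verts gadget_edges (Inl ` {(v, w) \<in> A. v \<in> T}) P \<and>
    card (Inl ` {(v, w) \<in> A. v \<in> T} :: ('a \<times> 'a + 'a \<times> bool) set) + 2 \<le> card P"
proof -
  define good where "good S \<longleftrightarrow> (\<exists>P. odd_barrier gadget_verts gadget_edges S P \<and> card S + 2 \<le> card P)" for S
  have "\<exists>S. good S" using gadget_barrier[OF no] by (auto simp: good_def)
  then obtain S where S: "good S" "\<And>S'. good S' \<Longrightarrow> card S \<le> card S'"
    using ex_has_least_nat[of good _ card] by blast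
  then obtain P where P: "odd_barrier gadget_verts gadget_edges S P" "card S + 2 \<le> card P" by (auto simp: good_def)
  have SG: "S \<subseteq> gadget_verts" using P(1) by (simp add: odd_barrier_def)
  have finS: "finite S" using SG gadget.finite_V finite_subset by blast
  have closed: "y \<in> K" if "K \<in> P" "x \<in> K" "{x, y} \<in> gadget_edges" "y \<notin> S" for K x y
  proof -
    have "\<forall>e\<in>gadget_edges. e \<inter> K \<noteq> {} \<longrightarrow> e \<subseteq> K \<union> S"
      using P(1) that(1) by (simp add: odd_barrier_def)
    from bspec[OF this that(3)] have "{x, y} \<inter> K \<noteq> {} \<longrightarrow> {x, y} \<subseteq> K \<union> S" .
    thus ?thesis using that(2,4) by simp
  qed
  have no_shrink: False if s: "s \<in> S"
    and "\<And>K. K \<in> P \<Longrightarrow> K \<inter> X \<noteq> {} \<Longrightarrow> X \<subseteq> K" "\<And>K. K \<in> P \<Longrightarrow> K \<inter> Y \<noteq> {} \<Longrightarrow> Y \<subseteq> K"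
    and "\<And>y. {s, y} \<in> gadget_edges \<Longrightarrow> y \<in> S \<union> X \<union> Y" for s X Y
  proof -
    note shrunk = barrier_shrink[OF gadget.finite_graph_axioms P(1) that]
    obtain P' where P': "odd_barrier gadget_verts gadget_edges (S - {s}) P'" "card P \<le> card P' + 1"
      using shrunk by blast
    have "card S = Suc (card (S - {s}))" using s finS card_Suc_Diff1 by metis
    hence "card (S - {s}) + 2 \<le> card P'" using P(2) P'(2) by linarith
    hence "good (S - {s})" using P'(1) by (auto simp: good_def)
    thus False using S(2) \<open>card S = Suc _\<close> by fastforce
  qed
  have no_Inr: "Inr (v, b) \<notin> S" for v b
  proof
    assume s: "Inr (v, b) \<in> S"
    define X :: "('a \<times> 'a + 'a \<times> bool) set" where "X = Inl ` {(u, w) \<in> A. u = v} - S"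
    show False
    proof (rule no_shrink[OF s, of X "{}"])
      fix K assume K: "K \<in> P" "K \<inter> X \<noteq> {}"
      then obtain w where w: "(v, w) \<in> A" "Inl (v, w) \<in> K" by (auto simp: X_def)
      show "X \<subseteq> K"
      proof
        fix y assume y: "y \<in> X"
        hence "y \<in> gadget_verts" "owner y = v" "y \<notin> S" by (auto simp: X_def gadget_verts_def)
        thus "y \<in> K" using end_adjacent[OF w(1), of y] closed[OF K(1) w(2), of y] w(2)
          by (cases "y = Inl (v, w)") auto
      qed
    next
      fix y assume y: "{Inr (v, b), y} \<in> gadget_edges"
      from y show "y \<in> S \<union> X \<union> {}"
      proof (cases rule: gadget_edge_cases)
        case (cross a c)
        thus ?thesis by auto
      next
        case (inner u w)
        have "owner (Inr (v, b)) = u" by (rule inner(3)) simp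
        moreover have "y = Inl (u, w)" using inner(2) by simp
        ultimately show ?thesis using inner(1) by (auto simp: X_def)
      qed
    qed auto
  qed
  have all_ends: "Inl (v, w') \<in> S" if s: "Inl (v, w) \<in> S" and w': "(v, w') \<in> A" for v w w'
  proof (rule ccontr)
    assume nS: "Inl (v, w') \<notin> S"
    define X where "X = {x \<in> gadget_verts. owner x = v} - S"
    define Y where "Y = {Inl (w, v)} - S"
    have vw: "(v, w) \<in> A" using s SG by (auto simp: gadget_verts_def)
    show False
    proof (rule no_shrink[OF s, of X Y])
      fix K assume K: "K \<in> P" "K \<inter> X \<noteq> {}"
      then obtain x where x: "x \<in> K" "x \<in> gadget_verts" "owner x = v" by (auto simp: X_def)
      have "Inl (v, w') \<in> K"
      proof (cases "x = Inl (v, w')")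
        case False
        hence "{x, Inl (v, w')} \<in> gadget_edges" using end_adjacent[OF w' x(2,3)] by (simp add: insert_commute)
        thus ?thesis using closed[OF K(1) x(1)] nS by blast
      qed (use x in simp)
      note c = closed[OF K(1) this]
      show "X \<subseteq> K"
      proof
        fix y assume "y \<in> X"
        hence "y \<in> gadget_verts" "owner y = v" "y \<notin> S" by (auto simp: X_def)
        thus "y \<in> K" using end_adjacent[OF w', of y] c[of y] \<open>Inl (v, w') \<in> K\<close>
          by (cases "y = Inl (v, w')") auto
      qed
    next
      fix K assume "K \<in> P" "K \<inter> Y \<noteq> {}"
      thus "Y \<subseteq> K" by (auto simp: Y_def)
    next
      fix y assume y: "{Inl (v, w), y} \<in> gadget_edges"
      have "y \<in> gadget_verts" using gadget.edge_sub[OF y] by simp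
      from y show "y \<in> S \<union> X \<union> Y"
      proof (cases rule: gadget_edge_cases)
        case (cross a b)
        hence "y = Inl (w, v)" by (auto simp: doubleton_eq_iff)
        thus ?thesis by (auto simp: Y_def)
      next
        case (inner u u')
        have "owner (Inl (v, w)) = u" "owner y = u" by (rule inner(3), simp)+
        hence "owner y = v" by simp
        thus ?thesis using \<open>y \<in> gadget_verts\<close> by (auto simp: X_def)
      qed
    qed
  qed
  define T where "T = {v. \<exists>w. Inl (v, w) \<in> S}"
  have "S = Inl ` {(v, w) \<in> A. v \<in> T}"
  proof (intro equalityI subsetI)
    fix x assume x: "x \<in> S"
    hence "x \<in> gadget_verts" using SG by blast
    thus "x \<in> Inl ` {(v, w) \<in> A. v \<in> T}" using x no_Inr unfolding gadget_verts_def T_def by blast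
  next
    fix x :: "'a \<times> 'a + 'a \<times> bool" assume "x \<in> Inl ` {(v, w) \<in> A. v \<in> T}"
    thus "x \<in> S" using all_ends by (auto simp: T_def)
  qed
  moreover have "T \<subseteq> V" using SG A_V by (auto simp: T_def gadget_verts_def)
  ultimately show ?thesis using P by blast
qed

text \<open>
  This is the hard direction of the parity factor theorem of Lovasz, for even factors. The odd sets that contain an extra vertex
  of \<open>T\<close> number at most \<open>2 * card T\<close>. Any other odd set is the union of the gadgets of a
  vertex set \<open>C\<close> disjoint from \<open>T\<close>, and its parity is that of the degree sum of \<open>C\<close>,
  that is, of the number of edges between \<open>C\<close> and \<open>T\<close>.
\<close>

lemma parity_barrier:
  assumes no: "\<nexists>F. F \<subseteq> A \<and> sym F \<and> (\<forall>v\<in>V. even (card (F `` {v})) \<and> F `` {v} \<noteq> {})"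
    and pos: "\<And>v. v \<in> V \<Longrightarrow> A `` {v} \<noteq> {}"
  shows "\<exists>T Q. T \<subseteq> V \<and> disjoint Q \<and> (\<Sum>v\<in>T. deg v) + 2 \<le> card Q + 2 * card T \<and>
    (\<forall>C\<in>Q. C \<subseteq> V - T \<and> A `` C \<subseteq> C \<union> T \<and> odd (card (A \<inter> C \<times> T)))"
proof -
  obtain T P where T: "T \<subseteq> V"
    and bar: "odd_barrier gadget_verts gadget_edges (Inl ` {(v, w) \<in> A. v \<in> T}) P"
    and cardP: "card (Inl ` {(v, w) \<in> A. v \<in> T} :: ('a \<times> 'a + 'a \<times> bool) set) + 2 \<le> card P"
    using gadget_barrier_full_ends[OF no] by blast
  define S :: "('a \<times> 'a + 'a \<times> bool) set" where "S = Inl ` {(v, w) \<in> A. v \<in> T}"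
  have finT: "finite T" using T finite_verts finite_subset by blast
  have PS: "disjoint P" "\<And>K. K \<in> P \<Longrightarrow> K \<subseteq> gadget_verts - S" "\<And>K. K \<in> P \<Longrightarrow> odd (card K)"
    "\<And>K e. K \<in> P \<Longrightarrow> e \<in> gadget_edges \<Longrightarrow> e \<inter> K \<noteq> {} \<Longrightarrow> e \<subseteq> K \<union> S"
    using bar unfolding S_def[symmetric] by (auto simp only: odd_barrier_def)
  have closed: "y \<in> K" if "K \<in> P" "x \<in> K" "{x, y} \<in> gadget_edges" "y \<notin> S" for K x y
    using PS(4)[OF that(1,3)] that(2,4) by simp
  have cardS: "card S = (\<Sum>v\<in>T. deg v)"
    unfolding S_def sum_deg[OF T] by (rule card_image) simp
  have finP: "finite P" using cardP card.infinite by fastforce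
  define X :: "('a \<times> 'a + 'a \<times> bool) set" where "X = Inr ` (T \<times> UNIV)"
  have X: "finite X" "card X = 2 * card T"
    unfolding X_def using finT by (auto simp: card_image card_cartesian_product)
  define P' where "P' = {K \<in> P. K \<inter> X = {}}"
  \<comment> \<open>Disjoint sets that all meet \<open>X\<close> are at most as many as the elements of \<open>X\<close>.\<close>
  have "card (P - P') \<le> card X"
    by (rule card_meeting_le) (use PS(1) X in \<open>auto simp: P'_def disjoint_def\<close>)
  moreover have "card P = card P' + card (P - P')"
    using finP card_Diff_subset[of P' P] card_mono[of P P'] finite_subset[of P' P] by (simp add: P'_def)
  ultimately have cP': "(\<Sum>v\<in>T. deg v) + 2 \<le> card P' + 2 * card T"
    using cardP X(2) cardS unfolding S_def by linarith
  have ownT: "owner ` K \<subseteq> V - T" if K: "K \<in> P'" for K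
  proof
    fix v assume "v \<in> owner ` K"
    then obtain x where x: "x \<in> K" "owner x = v" by blast
    have xG: "x \<in> gadget_verts" "x \<notin> S" "x \<notin> X" using PS(2)[of K] K x(1) by (auto simp: P'_def)
    have "v \<notin> T"
    proof
      assume "v \<in> T"
      thus False using xG x(2) by (cases x) (auto simp: gadget_verts_def S_def X_def)
    qed
    thus "v \<in> V - T" using owner_in_V[OF xG(1)] x(2) by blast
  qed
  have notS: "y \<notin> S" if "owner y \<notin> T" for y using that by (auto simp: S_def)
  have full: "K = {x \<in> gadget_verts. owner x \<in> owner ` K}" if K: "K \<in> P'" for K
  proof (intro equalityI subsetI)
    fix x assume "x \<in> K" thus "x \<in> {x \<in> gadget_verts. owner x \<in> owner ` K}"
      using PS(2)[of K] K by (auto simp: P'_def)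
  next
    fix y assume "y \<in> {x \<in> gadget_verts. owner x \<in> owner ` K}"
    then obtain x where x: "x \<in> K" "owner y = owner x" and y: "y \<in> gadget_verts" by auto
    define v where "v = owner x"
    have v: "v \<in> V" "v \<notin> T" using ownT[OF K] x(1) by (auto simp: v_def)
    obtain w where w: "(v, w) \<in> A" using pos[OF v(1)] by blast
    have KP: "K \<in> P" using K by (simp add: P'_def)
    have xG: "x \<in> gadget_verts" using PS(2)[OF KP] x(1) by blast
    have "Inl (v, w) \<in> K"
    proof (cases "x = Inl (v, w)")
      case False
      hence "{x, Inl (v, w)} \<in> gadget_edges" using end_adjacent[OF w xG] by (simp add: insert_commute v_def)
      moreover have "Inl (v, w) \<notin> S" using notS v(2) by simp
      ultimately show ?thesis using closed[OF KP x(1)] by blast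
    qed (use x in simp)
    thus "y \<in> K"
      using closed[OF KP _ end_adjacent[OF w y]] notS[of y] v(2) x(2) v_def by (cases "y = Inl (v, w)") auto
  qed
  define Q where "Q = (\<lambda>K. owner ` K) ` P'"
  have inj: "inj_on (\<lambda>K. owner ` K) P'"
  proof (rule inj_onI)
    fix K L assume KL: "K \<in> P'" "L \<in> P'" "owner ` K = owner ` L"
    have "K = {x \<in> gadget_verts. owner x \<in> owner ` K}" by (rule full[OF KL(1)])
    also have "\<dots> = L" unfolding KL(3) by (rule full[OF KL(2), symmetric])
    finally show "K = L" .
  qed
  hence cQ: "card Q = card P'" by (simp add: Q_def card_image)
  have "disjoint Q"
    unfolding disjoint_def
  proof (intro ballI impI)
    fix C D assume "C \<in> Q" "D \<in> Q" "C \<noteq> D"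
    then obtain K L where KL: "K \<in> P'" "L \<in> P'" "C = owner ` K" "D = owner ` L" "K \<noteq> L"
      by (auto simp: Q_def)
    hence "K \<inter> L = {}" using PS(1) by (auto simp: disjoint_def P'_def)
    moreover have False if v: "v \<in> C" "v \<in> D" for v
    proof -
      have "v \<in> V" using ownT[OF KL(1)] v KL by blast
      hence "Inr (v, True) \<in> gadget_verts" by (simp add: gadget_verts_def)
      hence "Inr (v, True) \<in> {x \<in> gadget_verts. owner x \<in> owner ` K}" "Inr (v, True) \<in> {x \<in> gadget_verts. owner x \<in> owner ` L}"
        using v unfolding KL(3,4) by simp_all
      hence "Inr (v, True) \<in> K" "Inr (v, True) \<in> L"
        using full[OF KL(1)] full[OF KL(2)] by simp_all
      thus False using \<open>K \<inter> L = {}\<close> by blast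
    qed
    ultimately show "C \<inter> D = {}" by blast
  qed
  moreover have "C \<subseteq> V - T \<and> A `` C \<subseteq> C \<union> T \<and> odd (card (A \<inter> C \<times> T))" if "C \<in> Q" for C
  proof -
    obtain K where K: "K \<in> P'" "C = owner ` K" using \<open>C \<in> Q\<close> by (auto simp: Q_def)
    have KP: "K \<in> P" using K by (simp add: P'_def)
    have CV: "C \<subseteq> V - T" using ownT[OF K(1)] K(2) by simp
    have AC: "A `` C \<subseteq> C \<union> T"
    proof
      fix w assume "w \<in> A `` C"
      then obtain v where v: "v \<in> C" "(v, w) \<in> A" by blast
      have "Inl (v, w) \<in> {x \<in> gadget_verts. owner x \<in> owner ` K}" using v K(2) by (simp add: gadget_verts_def)
      hence "Inl (v, w) \<in> K" using full[OF K(1)] by simp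
      hence "Inl (w, v) \<in> K" if "w \<notin> T"
        using closed[OF KP _ cross_edge[OF v(2)]] notS[of "Inl (w, v)"] that by simp
      thus "w \<in> C \<union> T" using K(2) by force
    qed
    have Keq: "K = Inl ` {(v, w) \<in> A. v \<in> C} \<union> Inr ` (C \<times> UNIV)"
      by (subst full[OF K(1)]) (use CV K(2) in \<open>auto simp: gadget_verts_def\<close>)
    have finC: "finite C" using CV finite_verts finite_subset by blast
    have fin1: "finite {(v, w) \<in> A. v \<in> C}" by (rule finite_subset[OF _ finite_A]) auto
    have "card K = card {(v, w) \<in> A. v \<in> C} + 2 * card C"
      by (subst Keq, subst card_Un_disjoint)
        (use finC fin1 in \<open>auto simp: card_image card_cartesian_product\<close>)
    hence "odd (card {(v, w) \<in> A. v \<in> C})" using PS(3)[OF KP] by simp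
    moreover have "{(v, w) \<in> A. v \<in> C} = (A \<inter> C \<times> C) \<union> (A \<inter> C \<times> T)" using AC by auto
    moreover have "card ((A \<inter> C \<times> C) \<union> (A \<inter> C \<times> T)) = card (A \<inter> C \<times> C) + card (A \<inter> C \<times> T)"
      by (rule card_Un_disjoint) (use finite_A CV in auto)
    moreover have "even (card (A \<inter> C \<times> C))"
      by (rule even_card_sym_irrefl) (use finite_A sym_A irrefl_A in \<open>auto simp: sym_def irrefl_def\<close>)
    ultimately show ?thesis using CV AC by simp
  qed
  ultimately show ?thesis using T cP' cQ by (intro exI[of _ T] exI[of _ Q]) auto
qed

text \<open>
  Parts with an odd number of edges to \<open>T\<close> have either one such edge or at least three. Let
  \<open>D\<close> be the degree sum of \<open>T\<close> and \<open>t\<close> its size. There are at least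
  \<open>D - 2 * t + 2\<close> parts and at most \<open>D\<close> edges, which forces at least
  \<open>D - 3 * t + 3\<close> parts with a single edge. Since \<open>D \<ge> d * t\<close> and \<open>d \<ge> 3\<close>, this
  number is at least \<open>(d - 3) * t + 3 \<ge> d\<close>.
\<close>

lemma pendant_parts:
  assumes no: "\<nexists>F. F \<subseteq> A \<and> sym F \<and> (\<forall>v\<in>V. even (card (F `` {v})) \<and> F `` {v} \<noteq> {})"
    and deg: "\<And>v. v \<in> V \<Longrightarrow> d \<le> deg v" and d: "3 \<le> d"
  shows "\<exists>T Q. T \<subseteq> V \<and> T \<noteq> {} \<and> disjoint Q \<and> card Q = d \<and>
    (\<forall>C\<in>Q. C \<subseteq> V - T \<and> A `` C \<subseteq> C \<union> T \<and> card (A \<inter> C \<times> T) = 1)"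
proof -
  have pos: "A `` {v} \<noteq> {}" if "v \<in> V" for v
    using deg[OF that] d by (auto simp: deg_def)
  obtain T Q where T: "T \<subseteq> V" and Q: "disjoint Q" and card: "(\<Sum>v\<in>T. deg v) + 2 \<le> card Q + 2 * card T"
    and C: "\<And>C. C \<in> Q \<Longrightarrow> C \<subseteq> V - T" "\<And>C. C \<in> Q \<Longrightarrow> A `` C \<subseteq> C \<union> T"
      "\<And>C. C \<in> Q \<Longrightarrow> odd (card (A \<inter> C \<times> T))"
    using parity_barrier[OF no pos] by metis
  define D q t where "D = (\<Sum>v\<in>T. deg v)" and "q = card Q" and "t = card T"
  have finQ: "finite Q" by (rule finite_subset[of _ "Pow V"]) (use C(1) finite_verts in auto)
  have finT: "finite T" using T finite_verts finite_subset by blast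
  have "T \<noteq> {}"
  proof
    assume "T = {}"
    hence "Q = {}" using C(3) by auto
    thus False using card \<open>T = {}\<close> by simp
  qed
  define Q1 where "Q1 = {C \<in> Q. card (A \<inter> C \<times> T) = 1}"
  have Q1: "Q1 \<subseteq> Q" "finite Q1" using finQ by (auto simp: Q1_def)
  have ge3: "3 \<le> card (A \<inter> C \<times> T)" if "C \<in> Q - Q1" for C
  proof -
    have "odd (card (A \<inter> C \<times> T))" "card (A \<inter> C \<times> T) \<noteq> 1" using that C(3) by (auto simp: Q1_def)
    thus ?thesis by presburger
  qed
  have "(\<Sum>C\<in>Q. card (A \<inter> C \<times> T)) = card (\<Union>C\<in>Q. A \<inter> C \<times> T)"
    by (rule card_UN_disjoint[symmetric]) (use finQ finite_A Q in \<open>auto simp: disjoint_def\<close>)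
  also have "\<dots> \<le> card ({(v, w) \<in> A. v \<in> T}\<inverse>)"
    using finite_A A_swap by (intro card_mono) (auto intro: finite_subset[OF _ finite_A])
  also have "\<dots> = D" unfolding D_def sum_deg[OF T] by (rule card_inverse)
  finally have le: "(\<Sum>C\<in>Q. card (A \<inter> C \<times> T)) \<le> D" .
  have "(\<Sum>C\<in>Q. card (A \<inter> C \<times> T)) = (\<Sum>C\<in>Q1. card (A \<inter> C \<times> T)) + (\<Sum>C\<in>Q - Q1. card (A \<inter> C \<times> T))"
    using sum.subset_diff[OF Q1(1) finQ] by (metis add.commute)
  moreover have "(\<Sum>C\<in>Q1. card (A \<inter> C \<times> T)) = card Q1" by (simp add: Q1_def)
  moreover have "3 * card (Q - Q1) \<le> (\<Sum>C\<in>Q - Q1. card (A \<inter> C \<times> T))"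
    using sum_bounded_below[of "Q - Q1" 3 "\<lambda>C. card (A \<inter> C \<times> T)"] ge3 by simp
  ultimately have "3 * card (Q - Q1) + card Q1 \<le> D" using le by linarith
  moreover have "card (Q - Q1) + card Q1 = q"
    using card_Diff_subset[OF Q1(2,1)] card_mono[OF finQ Q1(1)] by (simp add: q_def)
  ultimately have "3 * q \<le> D + 2 * card Q1" by linarith
  hence "D + 3 \<le> card Q1 + 3 * t" using card unfolding D_def[symmetric] q_def[symmetric] t_def[symmetric] by linarith
  moreover have "d * t \<le> D"
    using sum_bounded_below[of T d deg] deg T unfolding D_def t_def by (auto simp: mult.commute)
  moreover have "t \<ge> 1" using \<open>T \<noteq> {}\<close> finT by (simp add: t_def Suc_leI card_gt_0_iff)
  moreover have "d + 3 * t \<le> d * t + 3"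
  proof -
    obtain a b where "d = a + 3" "t = b + 1"
      using le_Suc_ex[OF d] le_Suc_ex[OF \<open>t \<ge> 1\<close>] by (auto simp: add.commute)
    thus ?thesis by (simp add: algebra_simps)
  qed
  ultimately have "d \<le> card Q1" by linarith
  then obtain Q' where Q': "Q' \<subseteq> Q1" "card Q' = d" using obtain_subset_with_card_n by metis
  have "disjoint Q'" using Q Q' Q1 unfolding disjoint_def by blast
  moreover have "\<forall>C\<in>Q'. C \<subseteq> V - T \<and> A `` C \<subseteq> C \<union> T \<and> card (A \<inter> C \<times> T) = 1"
  proof
    fix C assume "C \<in> Q'"
    hence C': "C \<in> Q" "card (A \<inter> C \<times> T) = 1" using Q'(1) by (auto simp: Q1_def)
    thus "C \<subseteq> V - T \<and> A `` C \<subseteq> C \<union> T \<and> card (A \<inter> C \<times> T) = 1"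
      using C(1,2)[OF C'(1)] by simp
  qed
  ultimately show ?thesis using T \<open>T \<noteq> {}\<close> Q'(2) by blast
qed

end

section \<open>Eigenvalues of adjacency matrices\<close>

lemma eigenvalue_adjacency_iff:
  assumes "pair_graph G"
  shows "eigenvalue (adjacency_matrix G) k \<longleftrightarrow>
    (\<exists>x. (\<exists>v\<in>pverts G. x v \<noteq> 0) \<and> (\<forall>v\<in>pverts G. (\<Sum>w | (v, w) \<in> parcs G. x w) = k * x v))"
  unfolding adjacency_matrix_def by (rule eigenvalue_adjacency_matrix_wrt_iff[OF assms vertex_list[OF assms]])

lemma finite_eigenvalues: "finite {k. eigenvalue (adjacency_matrix G) k}"
proof -
  have "adjacency_matrix G \<in> carrier_mat (length (vertex_list G)) (length (vertex_list G))"
    by (simp add: adjacency_matrix_def adjacency_matrix_wrt_def)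
  from card_finite_spectrum(1)[OF this] show ?thesis by (simp add: spectrum_def)
qed

text \<open>
  For a symmetric \<open>A\<close> and \<open>A v = k v\<close>, both the form \<open>v\<^sup>* A v\<close> and the squared norm of
  \<open>v\<close> are real, and \<open>k\<close> is their quotient.
\<close>

lemma symmetric_eigenvalue_real:
  fixes A :: "real mat"
  assumes A: "A \<in> carrier_mat n n" and sym: "\<And>i j. i < n \<Longrightarrow> j < n \<Longrightarrow> A $$ (i, j) = A $$ (j, i)"
    and ev: "eigenvalue (map_mat complex_of_real A) k"
  shows "k \<in> \<real>"
proof -
  let ?B = "map_mat complex_of_real A"
  obtain v where v: "v \<in> carrier_vec n" "v \<noteq> 0\<^sub>v n" "?B *\<^sub>v v = k \<cdot>\<^sub>v v"
    using ev A by (auto simp: eigenvalue_def eigenvector_def)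
  have row: "(\<Sum>j<n. of_real (A $$ (i, j)) * v $ j) = k * v $ i" if i: "i < n" for i
  proof -
    have "(?B *\<^sub>v v) $ i = (\<Sum>j = 0..<n. of_real (A $$ (i, j)) * v $ j)"
      using i A v(1) by (auto simp: scalar_prod_def intro!: sum.cong)
    thus ?thesis using v(1,3) i by (simp add: lessThan_atLeast0)
  qed
  define q where "q = (\<Sum>i<n. \<Sum>j<n. cnj (v $ i) * (of_real (A $$ (i, j)) * v $ j))"
  define N where "N = (\<Sum>i<n. (cmod (v $ i))\<^sup>2)"
  have "cnj q = (\<Sum>i<n. \<Sum>j<n. v $ i * (of_real (A $$ (i, j)) * cnj (v $ j)))"
    by (simp add: q_def)
  also have "\<dots> = (\<Sum>j<n. \<Sum>i<n. v $ i * (of_real (A $$ (i, j)) * cnj (v $ j)))"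
    by (rule sum.swap)
  also have "\<dots> = q"
    unfolding q_def by (intro sum.cong refl) (simp add: sym mult_ac)
  finally have cq: "cnj q = q" .
  have "q = (\<Sum>i<n. cnj (v $ i) * (k * v $ i))"
    unfolding q_def by (intro sum.cong refl) (simp add: sum_distrib_left[symmetric] row)
  also have "\<dots> = (\<Sum>i<n. k * of_real ((cmod (v $ i))\<^sup>2))"
    by (intro sum.cong refl) (simp only: complex_norm_square mult_ac)
  also have "\<dots> = k * of_real N" by (simp add: N_def sum_distrib_left)
  finally have qk: "q = k * of_real N" .
  have "N \<noteq> 0"
  proof
    assume "N = 0"
    hence "\<forall>i<n. v $ i = 0" by (simp add: N_def sum_nonneg_eq_0_iff)
    hence "v = 0\<^sub>v n" using v(1) by (intro eq_vecI) auto
    thus False using v(2) by blast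
  qed
  hence "cnj k = k" using cq qk by simp
  thus ?thesis by (simp add: Reals_cnj_iff)
qed

text \<open>
  The spectral radius is the maximum of a set of real numbers, which says something only if that set is
  not empty. The complex spectrum is not empty, and it is real by symmetry.
\<close>

lemma ex_eigenvalue_adjacency:
  assumes G: "pair_graph G" and ne: "pverts G \<noteq> {}"
  shows "\<exists>k. eigenvalue (adjacency_matrix G) k"
proof -
  let ?A = "adjacency_matrix G" let ?n = "length (vertex_list G)"
  interpret pair_graph G by (rule G)
  have A: "?A \<in> carrier_mat ?n ?n" by (simp add: adjacency_matrix_def adjacency_matrix_wrt_def)
  have "?n \<noteq> 0" using vertex_list(2)[OF G] ne by auto
  hence "spectrum (map_mat complex_of_real ?A) \<noteq> {}" using A by (intro spectrum_non_empty[of _ ?n]) auto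
  then obtain k where k: "eigenvalue (map_mat complex_of_real ?A) k" by (auto simp: spectrum_def)
  have "(u, v) \<in> parcs G \<longleftrightarrow> (v, u) \<in> parcs G" for u v
    using graph_symmetric by blast
  hence "k \<in> \<real>"
    by (intro symmetric_eigenvalue_real[OF A _ k]) (simp add: adjacency_matrix_def adjacency_matrix_wrt_def)
  then obtain r where r: "k = complex_of_real r" by (auto elim: Reals_cases)
  have "poly (char_poly (map_mat complex_of_real ?A)) (complex_of_real r) = 0"
    using k r A by (simp add: eigenvalue_root_char_poly[of _ ?n])
  hence "poly (char_poly ?A) r = 0"
    by (simp add: of_real_hom.char_poly_hom[OF A])
  thus ?thesis using eigenvalue_root_char_poly[OF A] by blast
qed

lemma spectral_radius_eigenvalue:
  assumes "pair_graph G" "pverts G \<noteq> {}"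
  shows "eigenvalue (adjacency_matrix G) (graph_spectral_radius G)"
  using Max_in[OF finite_eigenvalues[of G]] ex_eigenvalue_adjacency[OF assms]
  unfolding graph_spectral_radius_def by blast

lemma eigenvalue_le_spectral_radius: "eigenvalue (adjacency_matrix G) k \<Longrightarrow> k \<le> graph_spectral_radius G"
  unfolding graph_spectral_radius_def by (intro Max_ge finite_eigenvalues) simp

text \<open>
  A positive vector \<open>x\<close> that is expanded by at most \<open>l\<close> under \<open>R\<close> bounds all
  eigenvalues of subgraphs of \<open>R\<close>: at a vertex where \<open>\<bar>y\<bar> / x\<close> attains its maximum
  \<open>c\<close>, the eigenvalue equation for \<open>y\<close> and the triangle inequality give \<open>m \<le> l\<close>. In the case
  of equality there is no slack: every \<open>R\<close>-neighbour of such a vertex is joined to it in the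
  subgraph as well and also attains the maximum. With \<open>x = 1\<close> this is the bound by the maximum
  degree; with \<open>x\<close> the Perron vector of a connected graph it is the strict monotonicity of the
  spectral radius.
\<close>

lemma eigenvalue_comparison:
  fixes x y :: "'a \<Rightarrow> real"
  assumes V: "finite V" and BR: "B \<subseteq> R" and RV: "R \<subseteq> V \<times> V"
    and x: "\<And>v. v \<in> V \<Longrightarrow> 0 < x v"
    and super: "\<And>v. v \<in> V \<Longrightarrow> (\<Sum>w | (v, w) \<in> R. x w) \<le> l * x v"
    and y0: "\<exists>v\<in>V. y v \<noteq> 0"
    and y: "\<And>v. v \<in> V \<Longrightarrow> (\<Sum>w | (v, w) \<in> B. y w) = m * y v"
  shows "m \<le> l" (is ?th1)
    and "l \<le> m \<Longrightarrow> \<exists>Z\<subseteq>V. Z \<noteq> {} \<and> (\<forall>v\<in>Z. \<forall>w. (v, w) \<in> R \<longrightarrow> (v, w) \<in> B \<and> w \<in> Z)" (is "_ \<Longrightarrow> ?th2")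
proof -
  define c where "c = Max ((\<lambda>v. \<bar>y v\<bar> / x v) ` V)"
  have le: "\<bar>y v\<bar> \<le> c * x v" if "v \<in> V" for v
  proof -
    have "\<bar>y v\<bar> / x v \<le> c" unfolding c_def using V that by (intro Max_ge) auto
    thus ?thesis using x[OF that] by (simp add: pos_divide_le_eq)
  qed
  define Z where "Z = {v \<in> V. \<bar>y v\<bar> = c * x v}"
  have "c \<in> (\<lambda>v. \<bar>y v\<bar> / x v) ` V" unfolding c_def by (rule Max_in) (use V y0 in auto)
  then obtain u where u: "u \<in> V" "c = \<bar>y u\<bar> / x u" by blast
  hence uZ: "u \<in> Z" using x[OF u(1)] by (simp add: Z_def)
  have c: "0 < c"
  proof -
    obtain v where v: "v \<in> V" "y v \<noteq> 0" using y0 by blast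
    hence "0 < c * x v" using le[OF v(1)] by simp
    thus ?thesis using x[OF v(1)] by (simp add: zero_less_mult_iff)
  qed
  have fin: "finite {w. (v, w) \<in> R}" for v by (rule finite_subset[OF _ V]) (use RV in auto)
  have wR: "w \<in> V" if "(v, w) \<in> R" for v w using RV that by blast
  have wB: "w \<in> V" if "(v, w) \<in> B" for v w using wR BR that by blast
  have chain: "m * (c * x v) \<le> (\<Sum>w | (v, w) \<in> B. \<bar>y w\<bar>)"
    "(\<Sum>w | (v, w) \<in> B. \<bar>y w\<bar>) \<le> (\<Sum>w | (v, w) \<in> B. c * x w)"
    "(\<Sum>w | (v, w) \<in> B. c * x w) \<le> (\<Sum>w | (v, w) \<in> R. c * x w)"
    "(\<Sum>w | (v, w) \<in> R. c * x w) \<le> l * (c * x v)" if v: "v \<in> Z" for v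
  proof -
    have vV: "v \<in> V" and yv: "\<bar>y v\<bar> = c * x v" using v by (auto simp: Z_def)
    have "m * \<bar>y v\<bar> \<le> \<bar>m * y v\<bar>" by (simp add: abs_mult mult_right_mono)
    hence "m * (c * x v) \<le> \<bar>m * y v\<bar>" by (simp only: yv)
    also have "\<dots> = \<bar>\<Sum>w | (v, w) \<in> B. y w\<bar>" using y[OF vV] by simp
    also have "\<dots> \<le> (\<Sum>w | (v, w) \<in> B. \<bar>y w\<bar>)" by (rule sum_abs)
    finally show "m * (c * x v) \<le> (\<Sum>w | (v, w) \<in> B. \<bar>y w\<bar>)" .
    show "(\<Sum>w | (v, w) \<in> B. \<bar>y w\<bar>) \<le> (\<Sum>w | (v, w) \<in> B. c * x w)"
      by (intro sum_mono le wB) simp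
    show "(\<Sum>w | (v, w) \<in> B. c * x w) \<le> (\<Sum>w | (v, w) \<in> R. c * x w)"
    proof (rule sum_mono2[OF fin])
      show "{w. (v, w) \<in> B} \<subseteq> {w. (v, w) \<in> R}" using BR by blast
      show "0 \<le> c * x w" if "w \<in> {w. (v, w) \<in> R} - {w. (v, w) \<in> B}" for w
        using that wR[of v w] x[of w] c by simp
    qed
    show "(\<Sum>w | (v, w) \<in> R. c * x w) \<le> l * (c * x v)"
      using mult_left_mono[OF super[OF vV], of c] c by (simp add: sum_distrib_left mult_ac)
  qed
  have "m * (c * x u) \<le> l * (c * x u)" using chain[OF uZ] by linarith
  thus ml: ?th1 using c x[OF u(1)] by simp
  assume "l \<le> m"
  hence "m = l" using ml by (rule antisym[rotated])
  have "(v, w) \<in> B \<and> w \<in> Z" if v: "v \<in> Z" and w: "(v, w) \<in> R" for v w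
  proof -
    have eq1: "(\<Sum>w | (v, w) \<in> B. \<bar>y w\<bar>) = (\<Sum>w | (v, w) \<in> B. c * x w)"
      and eq2: "(\<Sum>w | (v, w) \<in> B. c * x w) = (\<Sum>w | (v, w) \<in> R. c * x w)"
      using chain[OF v, unfolded \<open>m = l\<close>] by linarith+
    have finB: "finite {w. (v, w) \<in> B}" by (rule finite_subset[OF _ fin[of v]]) (use BR in auto)
    have vwB: "(v, w) \<in> B"
    proof (rule ccontr)
      assume "(v, w) \<notin> B"
      have "(\<Sum>w | (v, w) \<in> B. c * x w) < (\<Sum>w | (v, w) \<in> R. c * x w)"
      proof (rule sum_strict_mono2[OF fin, of _ _ w])
        show "{w. (v, w) \<in> B} \<subseteq> {w. (v, w) \<in> R}" using BR by blast
        show "w \<in> {w. (v, w) \<in> R} - {w. (v, w) \<in> B}" using w \<open>(v, w) \<notin> B\<close> by simp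
        show "0 < c * x w" using c x[OF wR[OF w]] by simp
        show "0 \<le> c * x w'" if "w' \<in> {w. (v, w) \<in> R}" for w'
          using that wR[of v w'] x[of w'] c by simp
      qed
      thus False using eq2 by simp
    qed
    have "\<bar>y w\<bar> = c * x w"
    proof (rule ccontr)
      assume "\<bar>y w\<bar> \<noteq> c * x w"
      hence "\<bar>y w\<bar> < c * x w" using le[OF wR[OF w]] by simp
      hence "(\<Sum>w | (v, w) \<in> B. \<bar>y w\<bar>) < (\<Sum>w | (v, w) \<in> B. c * x w)"
        using vwB wB le by (intro sum_strict_mono_ex1[OF finB]) blast+
      thus False using eq1 by simp
    qed
    thus ?thesis using vwB wR[OF w] by (simp add: Z_def)
  qed
  moreover have "Z \<subseteq> V" by (auto simp: Z_def)
  ultimately show ?th2 using uZ by blast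
qed

text \<open>
  This is the eigenvalue equation at the hub of the extremal graph, with \<open>N\<close> the size of the
  large clique, once the equations at all other vertices have been solved. Only a root above \<open>N - 1\<close> is of interest, so the left end of the interval for the
  intermediate value theorem has to lie slightly to the right of \<open>N - 1\<close>: for \<open>N = d + 1\<close>
  the last summand is a division by zero at \<open>N - 1\<close> itself.
\<close>

lemma A_graph_hub_equation_root:
  fixes N d :: real
  assumes d: "3 \<le> d" and N: "d + 1 \<le> N"
  shows "\<exists>k>N - 1. k * ((k + 1) * (k - N + 1)) =
    (k - N + 2) + (d - 1) * ((k - d + 1) * ((k - N + 1) / (k - d)))"
proof -
  define g where "g k = k * ((k + 1) * (k - N + 1)) -
    ((k - N + 2) + (d - 1) * ((k - d + 1) * ((k - N + 1) / (k - d))))" for k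
  \<comment> \<open>Chosen such that \<open>k * (k + 1) * e \<le> 1\<close> for \<open>k \<le> N\<close>.\<close>
  define e where "e = 1 / (N * (N + 1))"
  have e: "0 < e" "e \<le> 1" using d N by (auto simp: e_def divide_simps) (smt (verit) mult_le_cancel_left1)
  have "g (N - 1 + e) \<le> 0"
  proof -
    have "(N - 1 + e) * (N - 1 + e + 1) \<le> N * (N + 1)" using e d N by (intro mult_mono) auto
    hence "(N - 1 + e) * (N - 1 + e + 1) * e \<le> N * (N + 1) * e" using e by (intro mult_right_mono) auto
    also have "\<dots> = 1" using d N by (simp add: e_def)
    finally have "(N - 1 + e) * ((N - 1 + e + 1) * e) \<le> 1" by (simp add: mult.assoc)
    moreover have "0 \<le> (d - 1) * ((N - 1 + e - d + 1) * (e / (N - 1 + e - d)))"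
      using e d N by (intro mult_nonneg_nonneg divide_nonneg_nonneg) auto
    ultimately show ?thesis using e by (simp add: g_def)
  qed
  moreover have "0 \<le> g N"
  proof -
    define q where "q = (d - 1) * ((N - d + 1) * (1 / (N - d)))"
    have "(N - d + 1) * (1 / (N - d)) \<le> 2" using N by (simp add: divide_simps)
    hence "q \<le> (d - 1) * 2" unfolding q_def using d by (intro mult_left_mono) auto
    moreover have "2 * N \<le> N\<^sup>2" using d N unfolding power2_eq_square by (intro mult_right_mono) auto
    moreover have "g N = N\<^sup>2 + N - (2 + q)"
      by (simp add: g_def q_def distrib_left power2_eq_square)
    moreover have "(d - 1) * 2 = 2 * d - 2" by simp
    ultimately show ?thesis using N d by (smt (verit))
  qed
  moreover have "continuous_on {N - 1 + e..N} g"
    unfolding g_def using N e by (intro continuous_intros) auto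
  ultimately obtain k where "N - 1 + e \<le> k" "g k = 0"
    using IVT'[of g "N - 1 + e" 0 N] e by auto
  thus ?thesis using e by (intro exI[of _ k]) (auto simp: g_def)
qed

text \<open>
  The vector is constant on the other vertices of the large clique, on those of the small cliques, and on
  the roots of each kind. Starting with the value \<open>1\<close> in the large clique, the equations at its
  vertices determine its root and the hub, those of a small clique then determine its values, and the
  equation at the hub is the one solved above. The inequality \<open>k > N - 1\<close> makes all
  values positive.
\<close>

lemma A_graph_positive_eigenvector:
  assumes d: "3 \<le> d" and n: "d\<^sup>2 + d + 1 \<le> n"
  shows "\<exists>k x. real (n - d\<^sup>2) - 1 < k \<and> (\<forall>v. v \<in> pverts (A_graph n d) \<longrightarrow> 0 < x v) \<and>
    (\<forall>v\<in>pverts (A_graph n d). (\<Sum>w | (v, w) \<in> parcs (A_graph n d). x w) = k * x v)"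
proof -
  define N where "N = real (n - d\<^sup>2)"
  define D where "D = real d"
  have Nn: "d + 1 \<le> n - d\<^sup>2" using n by simp
  hence N: "D + 1 \<le> N" unfolding N_def D_def by linarith
  have D: "3 \<le> D" using d by (simp add: D_def)
  obtain k where k: "N - 1 < k" and hub: "k * ((k + 1) * (k - N + 1)) =
    (k - N + 2) + (D - 1) * ((k - D + 1) * ((k - N + 1) / (k - D)))"
    using A_graph_hub_equation_root[OF D N] by blast
  define t where "t = (k - N + 1) / (k - D)"
  define s where "s i = (if i = 0 then 1 else t)" for i :: nat
  define r where "r i = (if i = 0 then k - N + 2 else (k - D + 1) * t)" for i :: nat
  define h where "h = (k + 1) * (k - N + 1)"
  define x where "x v = (case v of Hub \<Rightarrow> h | Cl i j \<Rightarrow> if j = 0 then r i else s i)" for v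
  have t: "0 < t" using k N by (simp add: t_def)
  have pos: "0 < x v" for v
    using k N D t by (cases v) (auto simp: x_def h_def r_def s_def intro!: mult_pos_pos)
  have c1: "1 \<le> clique_size n d i" for i using Nn by (simp add: clique_size_def)
  have other: "r i + (real (clique_size n d i) - 2) * s i = k * s i" for i
    by (simp add: r_def s_def clique_size_def N_def D_def algebra_simps)
  have "(k - D) * t = k - N + 1" using k N by (simp add: t_def)
  hence "(k + 1) * ((k - D) * t) = h" by (simp add: h_def)
  hence root: "(real (clique_size n d i) - 1) * s i + h = k * r i" for i
    by (simp add: r_def s_def clique_size_def N_def[symmetric] D_def[symmetric] h_def algebra_simps)
  have clique: "(\<Sum>l<clique_size n d i. x (Cl i l)) = r i + (real (clique_size n d i) - 1) * s i" for i
  proof -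
    obtain m where m: "clique_size n d i = Suc m" using c1[of i] by (cases "clique_size n d i") auto
    show ?thesis unfolding m by (subst sum.lessThan_Suc_shift) (simp add: x_def)
  qed
  have rest: "(\<Sum>l\<in>{..<clique_size n d i} - {j}. x (Cl i l)) = r i + (real (clique_size n d i) - 1) * s i - x (Cl i j)"
    if "j < clique_size n d i" for i j
    using sum_diff1[of "{..<clique_size n d i}" "\<lambda>l. x (Cl i l)" j] that clique[of i] by simp
  have img: "(\<Sum>w\<in>Cl i ` L. x w) = (\<Sum>l\<in>L. x (Cl i l))" for i L
    by (subst sum.reindex) (auto simp: inj_on_def)
  have "(\<Sum>w | (v, w) \<in> parcs (A_graph n d). x w) = k * x v" if v: "v \<in> pverts (A_graph n d)" for v
  proof (cases v)
    case Hub
    have "{w. (v, w) \<in> parcs (A_graph n d)} = (\<lambda>i. Cl i 0) ` {..<d}"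
      unfolding Hub by (auto simp: A_graph_def)
    hence "(\<Sum>w | (v, w) \<in> parcs (A_graph n d). x w) = (\<Sum>i<d. r i)"
      by (simp add: sum.reindex inj_on_def x_def)
    also have "\<dots> = r 0 + (D - 1) * r 1"
    proof -
      obtain m where m: "d = Suc m" using d by (cases d) auto
      show ?thesis unfolding D_def m by (subst sum.lessThan_Suc_shift) (simp add: r_def)
    qed
    also have "\<dots> = k * x v" using hub by (simp add: Hub x_def r_def h_def t_def)
    finally show ?thesis .
  next
    case (Cl i j)
    have ij: "i < d" "j < clique_size n d i" using v Cl by (auto simp: A_graph_def)
    show ?thesis
    proof (cases "j = 0")
      case False
      have "{w. (v, w) \<in> parcs (A_graph n d)} = Cl i ` ({..<clique_size n d i} - {j})"
        unfolding Cl using ij False by (auto simp: A_graph_def)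
      moreover have "x (Cl i j) = s i" using False by (simp add: x_def)
      ultimately show ?thesis using rest[OF ij(2)] other[of i] by (simp add: img Cl algebra_simps)
    next
      case True
      have "{w. (v, w) \<in> parcs (A_graph n d)} = insert Hub (Cl i ` ({..<clique_size n d i} - {j}))"
        unfolding Cl using ij True by (auto simp: A_graph_def)
      moreover have "Hub \<notin> Cl i ` ({..<clique_size n d i} - {j})" by auto
      moreover have "x (Cl i j) = r i" "x Hub = h" using True by (simp_all add: x_def)
      ultimately show ?thesis using rest[OF ij(2)] root[of i] by (simp add: img Cl algebra_simps)
    qed
  qed
  thus ?thesis using k pos unfolding N_def by blast
qed

section \<open>Graphs with pendant parts\<close>

lemma bij_onto_initial_segment:
  assumes "finite X" "a \<in> X"
  shows "\<exists>h. bij_betw h X {..<card X} \<and> h a = (0::nat)"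
proof -
  have c: "card X = Suc (card (X - {a}))" using assms card_Suc_Diff1 by metis
  obtain h where h: "bij_betw h (X - {a}) {0..<card (X - {a})}"
    using ex_bij_betw_finite_nat[of "X - {a}"] assms(1) by auto
  define g where "g x = (if x = a then 0 else Suc (h x))" for x
  have "bij_betw (\<lambda>x. Suc (h x)) (X - {a}) (Suc ` {0..<card (X - {a})})"
    using bij_betw_trans[OF h inj_on_imp_bij_betw[of Suc]] by (simp add: comp_def)
  hence "bij_betw g (X - {a}) {1..<card X}"
    unfolding c by (subst bij_betw_cong[of _ _ "\<lambda>x. Suc (h x)"]) (auto simp: g_def image_Suc_atLeastLessThan)
  moreover have "bij_betw g {a} {0}" by (simp add: g_def bij_betw_def)
  ultimately have "bij_betw g (X - {a} \<union> {a}) ({1..<card X} \<union> {0})"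
    by (rule bij_betw_combine) simp
  moreover have "X - {a} \<union> {a} = X" "{1..<card X} \<union> {0} = {..<card X}" using assms(2) c by auto
  ultimately show ?thesis by (intro exI[of _ g]) (simp add: g_def)
qed

context sym_arcs
begin

text \<open>
  Let \<open>N = n - d\<^sup>2\<close> be the size of the large clique of the extremal graph. Each pendant part has
  a vertex whose neighbours all lie in the part, so it has at least \<open>d + 1\<close> vertices. Let
  \<open>W\<close> be the set of the vertices outside the parts; it contains \<open>T\<close>, so it is not empty.
  Counting vertices, \<open>W\<close> has at most \<open>N - d\<close> of them, hence degrees in \<open>W\<close> are at most
  \<open>(N - d - 1) + d = N - 1\<close>. A vertex in a part has degree at most the size of the part. So either
  all degrees are at most \<open>N - 1\<close>, or some part has at least \<open>N\<close> vertices. In the latter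
  case the count is tight: that part has \<open>N\<close> vertices, the others have \<open>d + 1\<close>, and
  \<open>W\<close> is a single vertex, so the graph is contained in the extremal graph.
\<close>

lemma pendant_parts_dichotomy:
  assumes TV: "T \<subseteq> V" and T0: "T \<noteq> {}" and Q: "disjoint Q" and cQ: "card Q = d"
    and part: "\<And>C. C \<in> Q \<Longrightarrow> C \<subseteq> V - T" "\<And>C. C \<in> Q \<Longrightarrow> A `` C \<subseteq> C \<union> T"
      "\<And>C. C \<in> Q \<Longrightarrow> card (A \<inter> C \<times> T) = 1"
    and deg: "\<And>v. v \<in> V \<Longrightarrow> d \<le> deg v" and d: "3 \<le> d"
    and n: "card V = n" "d\<^sup>2 + d + 1 \<le> n"
  shows "(\<forall>v\<in>V. deg v + 1 \<le> n - d\<^sup>2) \<or>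
    (\<exists>f. bij_betw f V (pverts (A_graph n d)) \<and> (\<forall>(v, w)\<in>A. (f v, f w) \<in> parcs (A_graph n d)))"
proof -
  have "\<forall>C\<in>Q. \<exists>p. A \<inter> C \<times> T = {p}" using part(3) by (simp add: card_1_singleton_iff)
  from bchoice[OF this] obtain p where p: "\<And>C. C \<in> Q \<Longrightarrow> A \<inter> C \<times> T = {p C}" by auto
  \<comment> \<open>The arc that leaves \<open>C\<close> starts at the root \<open>a C\<close>.\<close>
  define a where "a C = fst (p C)" for C
  have aC: "a C \<in> C" if "C \<in> Q" for C
  proof -
    have "p C \<in> A \<inter> C \<times> T" using p[OF that] by simp
    thus ?thesis by (auto simp: a_def)
  qed
  have exit: "v = a C" "w = snd (p C)" if "C \<in> Q" "v \<in> C" "(v, w) \<in> A" "w \<in> T" for v w C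
  proof -
    have "(v, w) \<in> A \<inter> C \<times> T" using that by blast
    hence "p C = (v, w)" unfolding p[OF that(1)] by simp
    thus "v = a C" "w = snd (p C)" by (auto simp: a_def)
  qed
  have finC: "finite C" if "C \<in> Q" for C using part(1)[OF that] finite_verts finite_subset by blast
  have finQ: "finite Q" by (rule finite_subset[of _ "Pow V"]) (use part(1) finite_verts in auto)
  have degC: "deg v \<le> card C" "v \<noteq> a C \<Longrightarrow> deg v + 1 \<le> card C" if C: "C \<in> Q" and v: "v \<in> C" for v C
  proof -
    have nb: "A `` {v} \<subseteq> (C - {v}) \<union> {w \<in> T. (v, w) \<in> A}"
      using part(2)[OF C] v A_neq by blast
    have T1: "{w \<in> T. (v, w) \<in> A} \<subseteq> {snd (p C)}" using exit(2)[OF C v] by blast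
    have cC: "card (C - {v}) + 1 = card C" using finC[OF C] v by (metis Suc_eq_plus1 card_Suc_Diff1)
    have "deg v \<le> card ((C - {v}) \<union> {snd (p C)})"
      unfolding deg_def using nb T1 finC[OF C] by (intro card_mono) auto
    also have "\<dots> \<le> card (C - {v}) + card {snd (p C)}" by (rule card_Un_le)
    finally show "deg v \<le> card C" using cC by simp
    assume "v \<noteq> a C"
    hence "{w \<in> T. (v, w) \<in> A} = {}" using exit(1)[OF C v] by blast
    hence "A `` {v} \<subseteq> C - {v}" using nb by (simp only: Un_empty_right)
    hence "deg v \<le> card (C - {v})" unfolding deg_def using finC[OF C] by (intro card_mono) auto
    thus "deg v + 1 \<le> card C" using cC by simp
  qed
  have sizeC: "d + 1 \<le> card C" if C: "C \<in> Q" for C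
  proof -
    have CV: "C \<subseteq> V" using part(1)[OF C] by blast
    have "3 \<le> card C" using degC(1)[OF C aC[OF C]] deg[of "a C"] aC[OF C] CV d by fastforce
    hence "card C \<noteq> card {a C}" by simp
    hence "C \<noteq> {a C}" by metis
    then obtain v where "v \<in> C" "v \<noteq> a C" using aC[OF C] by blast
    thus ?thesis using degC(2)[OF C, of v] deg[of v] CV by fastforce
  qed
  define W where "W = V - \<Union>Q"
  have TW: "T \<subseteq> W" using TV part(1) by (auto simp: W_def)
  have finW: "finite W" using finite_verts by (simp add: W_def)
  have "W \<noteq> {}" using TW T0 by blast
  hence W1: "1 \<le> card W" using finW by (simp add: Suc_leI card_gt_0_iff)
  have nbW: "A `` {v} \<subseteq> (W - {v}) \<union> a ` Q" if v: "v \<in> W" for v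
  proof
    fix w assume "w \<in> A `` {v}"
    hence vw: "(v, w) \<in> A" by simp
    show "w \<in> (W - {v}) \<union> a ` Q"
    proof (cases "w \<in> W")
      case True
      thus ?thesis using A_neq[OF vw] by auto
    next
      case False
      then obtain C where C: "C \<in> Q" "w \<in> C" using A_V[OF vw] by (auto simp: W_def)
      have wv: "(w, v) \<in> A" by (rule A_swap[OF vw])
      hence "v \<in> T" using part(2)[OF C(1)] C v by (auto simp: W_def)
      hence "w = a C" using exit(1)[OF C(1,2) wv] by simp
      thus ?thesis using C(1) by blast
    qed
  qed
  have degW: "deg v + 1 \<le> card W + d" if v: "v \<in> W" for v
  proof -
    have "deg v \<le> card ((W - {v}) \<union> a ` Q)"
      unfolding deg_def using nbW[OF v] finW finQ by (intro card_mono) auto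
    also have "\<dots> \<le> card (W - {v}) + card (a ` Q)" by (rule card_Un_le)
    also have "card (a ` Q) \<le> d" using card_image_le[OF finQ, of a] cQ by simp
    also have "card (W - {v}) = card W - 1" using v finW by simp
    finally show ?thesis using W1 by linarith
  qed
  have QV: "\<Union>Q \<subseteq> V" using part(1) by blast
  have "card V = card W + card (\<Union>Q)"
    unfolding W_def using card_Diff_subset[OF finite_subset[OF QV finite_verts] QV]
      card_mono[OF finite_verts QV] by simp
  moreover have "card (\<Union>Q) = (\<Sum>C\<in>Q. card C)"
    by (rule card_Union_disjoint) (use Q finC in \<open>auto simp: disjoint_def pairwise_def disjnt_def\<close>)
  ultimately have total: "n = card W + (\<Sum>C\<in>Q. card C)" using n(1) by simp
  have sub_total: "card R * (d + 1) + (\<Sum>C\<in>Q - R. card C) + card W \<le> n" if R: "R \<subseteq> Q" for R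
  proof -
    have "card R * (d + 1) \<le> (\<Sum>C\<in>R. card C)" using sum_bounded_below[of R "d + 1" card] sizeC R by auto
    moreover have "(\<Sum>C\<in>Q. card C) = (\<Sum>C\<in>Q - R. card C) + (\<Sum>C\<in>R. card C)"
      by (rule sum.subset_diff[OF R finQ])
    ultimately show ?thesis using total by linarith
  qed
  \<comment> \<open>Subtraction-free forms of the vertex counts: \<open>m + 1\<close> and \<open>m\<close> parts remain after removing one or two.\<close>
  obtain m where m: "d = m + 2" using d le_Suc_ex[of 2 d] by auto
  have sq: "d\<^sup>2 = d * (d + 1) - d" "d\<^sup>2 = (m + 1) * (d + 1) + 1" "d\<^sup>2 = m * (d + 1) + (d + 1) + 1"
    by (simp_all add: m power2_eq_square algebra_simps)
  show ?thesis
  proof (cases "\<forall>C\<in>Q. card C + 1 \<le> n - d\<^sup>2")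
    case True
    have "deg v + 1 \<le> n - d\<^sup>2" if v: "v \<in> V" for v
    proof (cases "v \<in> W")
      case True
      have "d * (d + 1) + card W \<le> n" using sub_total[of Q] cQ by simp
      moreover have "d * (d + 1) = d\<^sup>2 + d" by (simp add: power2_eq_square)
      ultimately show ?thesis using degW[OF True] by linarith
    next
      case False
      then obtain C where C: "C \<in> Q" "v \<in> C" using v by (auto simp: W_def)
      thus ?thesis using degC(1)[OF C] True by fastforce
    qed
    thus ?thesis by blast
  next
    case False
    then obtain C0 where C0: "C0 \<in> Q" "n - d\<^sup>2 \<le> card C0" by (auto simp: not_le)
    have "card (Q - {C0}) = m + 1" using C0(1) finQ cQ m by simp
    moreover have "Q - (Q - {C0}) = {C0}" using C0(1) by blast
    ultimately have b0: "(m + 1) * (d + 1) + card C0 + card W \<le> n" using sub_total[of "Q - {C0}"] by simp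
    have cW: "card W = 1" and cC0: "card C0 = n - d\<^sup>2"
      using b0 C0(2) sq(2) W1 n(2) by linarith+
    have cC: "card C = d + 1" if C: "C \<in> Q" "C \<noteq> C0" for C
    proof -
      have "card (Q - {C0, C}) = m" using C0(1) C finQ cQ m by (simp add: card_Diff_subset)
      moreover have "Q - (Q - {C0, C}) = {C0, C}" using C0(1) C by blast
      ultimately have "m * (d + 1) + (card C0 + card C) + card W \<le> n"
        using sub_total[of "Q - {C0, C}"] C by simp
      thus ?thesis using C0(2) sq(3) W1 n(2) sizeC[OF C(1)] by linarith
    qed
    obtain u where u: "W = {u}" using cW by (auto simp: card_1_singleton_iff)
    have Tu: "T = {u}" using TW T0 u by blast
    obtain idx where idx: "bij_betw idx Q {..<d}" "idx C0 = 0"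
      using bij_onto_initial_segment[OF finQ C0(1)] cQ by auto
    have size: "card C = clique_size n d (idx C)" if C: "C \<in> Q" for C
    proof (cases "C = C0")
      case False
      hence "idx C \<noteq> 0"
        using inj_onD[OF bij_betw_imp_inj_on[OF idx(1)], of C C0] idx(2) C C0(1) by auto
      thus ?thesis using cC[OF C False] by (simp add: clique_size_def)
    qed (simp add: idx cC0 clique_size_def)
    have "\<forall>C\<in>Q. \<exists>h. bij_betw h C {..<card C} \<and> h (a C) = (0::nat)"
      by (intro ballI bij_onto_initial_segment finC aC)
    from bchoice[OF this] obtain pos where pos: "\<And>C. C \<in> Q \<Longrightarrow> bij_betw (pos C) C {..<card C}"
      "\<And>C. C \<in> Q \<Longrightarrow> pos C (a C) = (0::nat)" by auto
    define P where "P v = (THE C. C \<in> Q \<and> v \<in> C)" for v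
    have P: "P v = C" if "C \<in> Q" "v \<in> C" for v C
      unfolding P_def using that Q by (intro the_equality) (auto simp: disjoint_def)
    define f where "f v = (if v = u then Hub else Cl (idx (P v)) (pos (P v) v))" for v
    have uQ: "u \<notin> C" if "C \<in> Q" for C using u that by (auto simp: W_def)
    have fC: "f v = Cl (idx C) (pos C v)" if "C \<in> Q" "v \<in> C" for v C
      using uQ[OF that(1)] that P[OF that] by (auto simp: f_def)
    have fu: "f u = Hub" by (simp add: f_def)
    have cover: "v = u \<or> (\<exists>C\<in>Q. v \<in> C)" if "v \<in> V" for v using u that by (auto simp: W_def)
    have idx_lt: "idx C < d" if "C \<in> Q" for C using bij_betwE[OF idx(1)] that by blast
    have pos_lt: "pos C v < clique_size n d (idx C)" if "C \<in> Q" "v \<in> C" for C v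
      using bij_betwE[OF pos(1)[OF that(1)]] that size by auto
    have "inj_on f V"
    proof (rule inj_onI)
      fix v w assume vw: "v \<in> V" "w \<in> V" "f v = f w"
      show "v = w"
      proof (cases "v = u \<or> w = u")
        case True
        thus ?thesis using vw(3) by (auto simp: f_def split: if_splits)
      next
        case False
        then obtain C D where CD: "C \<in> Q" "v \<in> C" "D \<in> Q" "w \<in> D" using cover vw by blast
        have eq: "idx C = idx D" "pos C v = pos D w" using vw(3) fC CD by auto
        hence "C = D" using inj_onD[OF bij_betw_imp_inj_on[OF idx(1)] _ CD(1,3)] by blast
        thus ?thesis using eq(2) inj_onD[OF bij_betw_imp_inj_on[OF pos(1)[OF CD(1)]], of v w] CD by simp
      qed
    qed
    moreover have "f ` V = pverts (A_graph n d)"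
    proof (rule card_subset_eq)
      have "pair_graph (A_graph n d)" by (rule pair_graph_A_graph[OF d n(2)])
      thus "finite (pverts (A_graph n d))" by (simp add: pair_graph_def pair_digraph_def pair_fin_digraph.pair_finite_verts)
      show "f ` V \<subseteq> pverts (A_graph n d)"
      proof
        fix x assume "x \<in> f ` V"
        then obtain v where v: "v \<in> V" "x = f v" by blast
        show "x \<in> pverts (A_graph n d)"
        proof (cases "v = u")
          case True thus ?thesis using v fu by (simp add: A_graph_def)
        next
          case False
          then obtain C where C: "C \<in> Q" "v \<in> C" using cover v by blast
          thus ?thesis using v(2) fC[OF C] idx_lt[OF C(1)] pos_lt[OF C] by (simp add: A_graph_def)
        qed
      qed
      show "card (f ` V) = card (pverts (A_graph n d))"
        using card_image[OF \<open>inj_on f V\<close>] n card_A_graph[OF d n(2)] by simp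
    qed
    ultimately have bij: "bij_betw f V (pverts (A_graph n d))" by (simp add: bij_betw_def)
    have hub: "\<exists>i<d. f w = Cl i 0" if uw: "(u, w) \<in> A" for w
    proof -
      have "w \<in> (W - {u}) \<union> a ` Q" using nbW[of u] u uw by blast
      then obtain C where "C \<in> Q" "w = a C" using u by blast
      thus ?thesis using fC[OF _ aC] pos(2) idx_lt by auto
    qed
    have "(f v, f w) \<in> parcs (A_graph n d)" if vw: "(v, w) \<in> A" for v w
    proof (cases "v = u")
      case True
      thus ?thesis using hub[of w] vw fu by (auto simp: A_graph_def)
    next
      case v: False
      show ?thesis
      proof (cases "w = u")
        case True
        thus ?thesis using hub[of v] A_swap[OF vw] fu by (auto simp: A_graph_def)
      next
        case False
        obtain C where C: "C \<in> Q" "v \<in> C" using cover[OF A_V(1)[OF vw]] v by blast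
        have w: "w \<in> C" using part(2)[OF C(1)] C vw Tu False by blast
        have "pos C v \<noteq> pos C w"
          using inj_onD[OF bij_betw_imp_inj_on[OF pos(1)[OF C(1)]] _ C(2) w] A_neq[OF vw] by blast
        thus ?thesis using fC[OF C] fC[OF C(1) w] idx_lt[OF C(1)] pos_lt[OF C] pos_lt[OF C(1) w]
          by (simp add: A_graph_def)
      qed
    qed
    thus ?thesis using bij by blast
  qed
qed

end

text \<open>
  The extremal graph is connected, in the form in which the equality case of the comparison uses it.
\<close>

lemma A_graph_closed_set:
  assumes d: "3 \<le> d" and n: "d\<^sup>2 + d + 1 \<le> n"
    and Z: "Z \<subseteq> pverts (A_graph n d)" "Z \<noteq> {}"
    and closed: "\<And>v w. v \<in> Z \<Longrightarrow> (v, w) \<in> parcs (A_graph n d) \<Longrightarrow> w \<in> Z"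
  shows "Z = pverts (A_graph n d)"
proof -
  have c: "0 < clique_size n d i" for i using n by (simp add: clique_size_def)
  have arcs: "(Cl i j, Cl i 0) \<in> parcs (A_graph n d)" "(Cl i 0, Cl i j) \<in> parcs (A_graph n d)"
    if "i < d" "j < clique_size n d i" "j \<noteq> 0" for i j
    using that c[of i] by (simp_all add: A_graph_def)
  have harcs: "(Cl i 0, Hub) \<in> parcs (A_graph n d)" "(Hub, Cl i 0) \<in> parcs (A_graph n d)" if "i < d" for i
    using that by (simp_all add: A_graph_def)
  obtain z where z: "z \<in> Z" using Z(2) by blast
  have "Hub \<in> Z"
  proof (cases z)
    case (Cl i j)
    hence ij: "i < d" "j < clique_size n d i" using z Z(1) by (auto simp: A_graph_def)
    hence "Cl i 0 \<in> Z" using closed[OF _ arcs(1)[OF ij]] z Cl by (cases "j = 0") auto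
    thus ?thesis using closed harcs(1)[OF ij(1)] by blast
  qed (use z in simp)
  hence root: "Cl i 0 \<in> Z" if "i < d" for i using closed harcs(2)[OF that] by blast
  have "Cl i j \<in> Z" if "i < d" "j < clique_size n d i" for i j
    using closed[OF root arcs(2)[OF that]] root that by (cases "j = 0") auto
  thus ?thesis using Z(1) \<open>Hub \<in> Z\<close> by (auto simp: A_graph_def)
qed

section \<open>Graphs without an even factor and with large spectral radius\<close>

lemma digraph_isoI:
  assumes G: "wf_digraph (with_proj G)" and f: "bij_betw f (pverts G) (pverts H)"
    and arcs: "parcs H = (\<lambda>(v, w). (f v, f w)) ` parcs G"
  shows "digraph_iso (with_proj G) (with_proj H)"
proof -
  interpret wf_digraph "with_proj G" by (rule G)
  define h where "h = \<lparr> iso_verts = f, iso_arcs = (\<lambda>(v, w). (f v, f w)), iso_head = snd, iso_tail = fst \<rparr>"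
  have inj: "inj_on f (pverts G)" using f by (rule bij_betw_imp_inj_on)
  have "fst e \<in> pverts G" "snd e \<in> pverts G" if "e \<in> parcs G" for e
    using tail_in_verts[of e] head_in_verts[of e] that by auto
  hence "inj_on (\<lambda>(v, w). (f v, f w)) (parcs G)"
    using inj by (auto simp: inj_on_def)
  hence "pre_digraph.digraph_isomorphism (with_proj G) h"
    unfolding pre_digraph.digraph_isomorphism_def using inj G by (auto simp: h_def)
  moreover have "with_proj H = app_iso h (with_proj G)"
    using f arcs by (simp add: app_iso_def h_def with_proj_def bij_betw_def)
  ultimately show ?thesis unfolding digraph_iso_def by blast
qed

lemma card_out_arcs: "out_degree (with_proj G) v = card (parcs G `` {v})"
proof -
  have "out_arcs (with_proj G) v = Pair v ` (parcs G `` {v})" by (auto simp: out_arcs_def)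
  thus ?thesis by (simp add: out_degree_def card_image inj_on_def)
qed

lemma sym_arcs_pair_graph: "pair_graph G \<Longrightarrow> sym_arcs (pverts G) (parcs G)"
proof -
  assume "pair_graph G"
  then interpret pair_graph G .
  show ?thesis
  proof
    show "finite (pverts G)" by (rule pair_finite_verts)
    show "parcs G \<subseteq> pverts G \<times> pverts G" using in_arcsD1 in_arcsD2 by auto
    show "sym (parcs G)" using graph_symmetric by (auto intro: symI)
    show "irrefl (parcs G)" using pair_no_loops by (force simp: irrefl_def)
  qed
qed

lemma even_factorI:
  assumes G: "pair_graph G" and F: "F \<subseteq> parcs G" "sym F"
    and even: "\<forall>v\<in>pverts G. even (card (F `` {v})) \<and> F `` {v} \<noteq> {}"
  shows "even_factor \<lparr> pverts = pverts G, parcs = F \<rparr> G"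
proof -
  interpret pair_graph G by (rule G)
  let ?F = "\<lparr> pverts = pverts G, parcs = F \<rparr>"
  have fin: "finite (F `` {v})" for v
    by (rule finite_subset[OF _ pair_finite_verts]) (use F(1) in_arcsD2 in auto)
  have pg: "pair_graph ?F"
  proof
    show "finite (parcs ?F)" using finite_subset[OF F(1) pair_finite_arcs] by simp
    show "symmetric (with_proj ?F)" using F(2) by (simp add: symmetric_def)
    show "fst e \<noteq> snd e" if "e \<in> parcs ?F" for e using that F(1) pair_no_loops by auto
    show "fst e \<in> pverts ?F" "snd e \<in> pverts ?F" if "e \<in> parcs ?F" for e
      using that F(1) arc_fst_in_verts[of e] arc_snd_in_verts[of e] by auto
  qed (simp add: pair_finite_verts)
  interpret F: pair_graph ?F by (rule pg)
  have "subgraph (with_proj ?F) (with_proj G)"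
    by (rule subgraphI) (use F(1) F.wf_digraph wf_digraph in \<open>auto simp: compatible_def\<close>)
  thus ?thesis
    using pg even fin by (simp add: even_factor_def spanning_def card_out_arcs card_gt_0_iff)
qed

theorem theorem1p1:
  fixes G :: "'a pair_pre_digraph" and n \<delta> :: nat
  assumes "\<delta> \<ge> 3"
    and "n \<ge> \<delta>\<^sup>2 + \<delta> + 1"
    and "pair_graph G"
    and "Digraph_Component.connected (with_proj G)"
    and "card (pverts G) = n"
    and "min_degree G \<ge> \<delta>"
    and "graph_spectral_radius G \<ge> graph_spectral_radius (A_graph n \<delta>)"
    and "\<not> digraph_iso (with_proj G) (with_proj (A_graph n \<delta>))"
  shows "\<exists>F. even_factor F G"
proof (rule ccontr)
  assume contra: "\<not> ?thesis"
  note d = assms(1) and n = assms(2) and G = assms(3)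
  interpret pair_graph G by (rule G)
  interpret S: sym_arcs "pverts G" "parcs G" by (rule sym_arcs_pair_graph[OF G])
  let ?H = "A_graph n \<delta>" and ?\<rho> = "graph_spectral_radius G"
  have H: "pair_graph ?H" by (rule pair_graph_A_graph[OF d n])
  have ne: "pverts G \<noteq> {}" using assms(5) n by auto
  have deg: "\<delta> \<le> S.deg v" if "v \<in> pverts G" for v
  proof -
    have "min_degree G \<le> out_degree (with_proj G) v"
      unfolding min_degree_def using pair_finite_verts that by (intro Min_le) auto
    thus ?thesis using assms(6) by (simp add: S.deg_def card_out_arcs)
  qed
  have no: "\<nexists>F. F \<subseteq> parcs G \<and> sym F \<and> (\<forall>v\<in>pverts G. even (card (F `` {v})) \<and> F `` {v} \<noteq> {})"
    using even_factorI[OF G] contra by blast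
  obtain T Q where TQ: "T \<subseteq> pverts G" "T \<noteq> {}" "disjoint Q" "card Q = \<delta>"
    "\<And>C. C \<in> Q \<Longrightarrow> C \<subseteq> pverts G - T" "\<And>C. C \<in> Q \<Longrightarrow> parcs G `` C \<subseteq> C \<union> T"
    "\<And>C. C \<in> Q \<Longrightarrow> card (parcs G \<inter> C \<times> T) = 1"
    using S.pendant_parts[OF no deg d] by metis
  obtain y where y: "\<exists>v\<in>pverts G. y v \<noteq> 0"
    "\<And>v. v \<in> pverts G \<Longrightarrow> (\<Sum>w | (v, w) \<in> parcs G. y w) = ?\<rho> * y v"
    using spectral_radius_eigenvalue[OF G ne] eigenvalue_adjacency_iff[OF G] by blast
  obtain k x where k: "real (n - \<delta>\<^sup>2) - 1 < k" and x: "\<And>v. v \<in> pverts ?H \<Longrightarrow> 0 < x v"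
    "\<And>v. v \<in> pverts ?H \<Longrightarrow> (\<Sum>w | (v, w) \<in> parcs ?H. x w) = k * x v"
    using A_graph_positive_eigenvector[OF d n] by blast
  have "Hub \<in> pverts ?H" by (simp add: A_graph_def)
  hence "\<exists>v\<in>pverts ?H. x v \<noteq> 0" using x(1)[of Hub] by (intro bexI[of _ Hub]) auto
  hence "eigenvalue (adjacency_matrix ?H) k" using eigenvalue_adjacency_iff[OF H] x(2) by blast
  hence k_le: "k \<le> ?\<rho>" using eigenvalue_le_spectral_radius[of ?H k] assms(7) by linarith
  have arcs_sub: "parcs G \<subseteq> pverts G \<times> pverts G" by (rule S.arcs_sub)
  consider (small) "\<forall>v\<in>pverts G. S.deg v + 1 \<le> n - \<delta>\<^sup>2"
    | (embeds) f where "bij_betw f (pverts G) (pverts ?H)" "\<forall>(v, w)\<in>parcs G. (f v, f w) \<in> parcs ?H"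
    using S.pendant_parts_dichotomy[OF TQ deg d assms(5) n] by blast
  thus False
  proof cases
    case small
    have "?\<rho> \<le> real (n - \<delta>\<^sup>2) - 1"
    proof (rule eigenvalue_comparison(1)[OF pair_finite_verts subset_refl arcs_sub _ _ y(1) y(2)])
      fix v assume v: "v \<in> pverts G"
      have "card {w. (v, w) \<in> parcs G} + 1 \<le> n - \<delta>\<^sup>2"
        using small v by (simp add: S.deg_def Image_singleton)
      hence "real (card {w. (v, w) \<in> parcs G}) + 1 \<le> real (n - \<delta>\<^sup>2)" by linarith
      thus "(\<Sum>w | (v, w) \<in> parcs G. 1) \<le> (real (n - \<delta>\<^sup>2) - 1) * 1"
        by (simp del: of_nat_diff)
    qed auto
    thus False using k k_le by linarith
  next
    case embeds
    note f = embeds(1)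
    \<comment> \<open>The extremal graph, pulled back to the vertices of \<open>G\<close>.\<close>
    define R where "R = {(v, w). v \<in> pverts G \<and> w \<in> pverts G \<and> (f v, f w) \<in> parcs ?H}"
    have sub: "parcs G \<subseteq> R" using embeds(2) arcs_sub by (auto simp: R_def)
    have RV: "R \<subseteq> pverts G \<times> pverts G" by (auto simp: R_def)
    have fV: "f v \<in> pverts ?H" if "v \<in> pverts G" for v using bij_betwE[OF f] that by blast
    interpret H: pair_graph ?H by (rule H)
    have pull: "(\<Sum>w | (v, w) \<in> R. x (f w)) \<le> k * x (f v)" if v: "v \<in> pverts G" for v
    proof -
      have "bij_betw f {w. (v, w) \<in> R} {w. (f v, w) \<in> parcs ?H}"
      proof (rule bij_betw_subset[OF f])
        show "{w. (v, w) \<in> R} \<subseteq> pverts G" using RV by auto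
        show "f ` {w. (v, w) \<in> R} = {w. (f v, w) \<in> parcs ?H}"
        proof (intro equalityI subsetI)
          fix z assume z: "z \<in> {w. (f v, w) \<in> parcs ?H}"
          hence "z \<in> pverts ?H" using H.in_arcsD2 by blast
          then obtain w where "w \<in> pverts G" "z = f w" using f by (auto simp: bij_betw_def)
          thus "z \<in> f ` {w. (v, w) \<in> R}" using z v by (auto simp: R_def)
        qed (auto simp: R_def)
      qed
      from sum.reindex_bij_betw[OF this, of x] show ?thesis using x(2)[OF fV[OF v]] by simp
    qed
    obtain Z where Z: "Z \<subseteq> pverts G" "Z \<noteq> {}"
      "\<forall>v\<in>Z. \<forall>w. (v, w) \<in> R \<longrightarrow> (v, w) \<in> parcs G \<and> w \<in> Z"
      using eigenvalue_comparison(2)[OF pair_finite_verts sub RV _ pull y(1) y(2) k_le] x(1) fV by blast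
    have "f ` Z = pverts ?H"
    proof (rule A_graph_closed_set[OF d n])
      show "f ` Z \<subseteq> pverts ?H" using Z(1) fV by blast
      show "f ` Z \<noteq> {}" using Z(2) by blast
      fix z z' assume z: "z \<in> f ` Z" "(z, z') \<in> parcs ?H"
      then obtain v where v: "v \<in> Z" "z = f v" by blast
      have "z' \<in> pverts ?H" using z(2) H.in_arcsD2 by blast
      then obtain w where w: "w \<in> pverts G" "z' = f w" using f by (auto simp: bij_betw_def)
      hence "(v, w) \<in> R" using v z(2) Z(1) by (auto simp: R_def)
      thus "z' \<in> f ` Z" using Z(3) v(1) w(2) by blast
    qed
    hence "f ` Z = f ` pverts G" using f by (simp add: bij_betw_def)
    hence "Z = pverts G" using inj_on_image_eq_iff[OF bij_betw_imp_inj_on[OF f] Z(1) subset_refl] by simp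
    hence "R \<subseteq> parcs G" using Z(3) RV by blast
    hence RG: "R = parcs G" using sub by blast
    have "parcs ?H = (\<lambda>(v, w). (f v, f w)) ` parcs G"
    proof (intro equalityI subsetI)
      fix e assume e: "e \<in> parcs ?H"
      obtain z z' where zz: "e = (z, z')" by (cases e)
      hence "z \<in> f ` pverts G" "z' \<in> f ` pverts G"
        using e f H.in_arcsD1 H.in_arcsD2 by (auto simp: bij_betw_def)
      then obtain v w where "v \<in> pverts G" "w \<in> pverts G" "z = f v" "z' = f w" by blast
      hence "(v, w) \<in> R" using e zz by (simp add: R_def)
      thus "e \<in> (\<lambda>(v, w). (f v, f w)) ` parcs G"
        using RG zz \<open>z = f v\<close> \<open>z' = f w\<close> by force
    next
      fix e assume "e \<in> (\<lambda>(v, w). (f v, f w)) ` parcs G"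
      thus "e \<in> parcs ?H" using embeds(2) by auto
    qed
    hence "digraph_iso (with_proj G) (with_proj ?H)" by (rule digraph_isoI[OF wf_digraph_axioms f])
    thus False using assms(8) by blast
  qed
qed

end
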